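(* Fix $k\ge 2$. Over ${\sf RCA}_0$, the following are equivalent: (1) ${\Pi^1_1\text{-}}{\sf CA}_0$. (2) If $\langle H_i\rangle_{i\in\mathbb{N}}$ is a sequence of hypergraphs, then there is a function $f:\mathbb{N}\to 2$ such that $f(i)=1$ if and only if $H_i$ has a proper $k$-coloring. (3) Statement (2) with "proper" replaced by "conflict-free".
   Context: ${\sf RCA}_0$ is the base system of second order arithmetic; ${\Pi^1_1\text{-}}{\sf CA}_0$ is ${\sf RCA}_0$ plus comprehension for $\Pi^1_1$ formulas. A hypergraph consists of a vertex set $V\subseteq\mathbb{N}$ and a collection of edges, each a subset of $V$ of any cardinality (finite or infinite), presented e.g. by a sequence of characteristic functions of the edges. A vertex coloring $\chi:V\to\mathbb{N}$ is a $k$-coloring if its range is contained in $\{0,\dots,k-1\}$; it is proper if $\chi$ is non-constant on each edge containing more than one vertex; it is conflict-free if every edge $e$ contains a vertex whose color is shared by no other vertex of $e$, i.e. $\forall e\,\exists j\ |\{v\in e:\chi(v)=j\}|=1$. *)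

theory Defs
  imports Main
begin

section \<open>Structures for the language of second order arithmetic\<close>

text \<open>
  An L2-structure has the type \<^typ>\<open>'m\<close> as its (possibly nonstandard) number domain. Its set
  variables range over \<open>Sets M\<close>, an arbitrary nonempty collection of subsets of that domain, and
  the symbols \<open>\<in>\<close> and \<open>=\<close> have their true meaning.
\<close>

record 'm l2_structure =
  Zero :: 'm
  One :: 'm
  Add :: "'m \<Rightarrow> 'm \<Rightarrow> 'm"
  Mul :: "'m \<Rightarrow> 'm \<Rightarrow> 'm"
  Lt :: "'m \<Rightarrow> 'm \<Rightarrow> bool"
  Sets :: "'m set set"

text \<open>Number variables and set variables are two separate sorts, each indexed by \<^typ>\<open>nat\<close>.\<close>

datatype tm = Var nat | Zer | On | Plus tm tm | Times tm tm

datatype form =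
    Eq tm tm | Less tm tm | Mem tm nat
  | Neg form | And form form | Or form form | Imp form form | Iff form form
  | AllN nat form | ExN nat form
  | AllS nat form | ExS nat form

primrec tm_vars :: "tm \<Rightarrow> nat set" where
  "tm_vars (Var x) = {x}"
| "tm_vars Zer = {}"
| "tm_vars On = {}"
| "tm_vars (Plus s t) = tm_vars s \<union> tm_vars t"
| "tm_vars (Times s t) = tm_vars s \<union> tm_vars t"

primrec tm_val :: "'m l2_structure \<Rightarrow> (nat \<Rightarrow> 'm) \<Rightarrow> tm \<Rightarrow> 'm" where
  "tm_val M e (Var x) = e x"
| "tm_val M e Zer = Zero M"
| "tm_val M e On = One M"
| "tm_val M e (Plus s t) = Add M (tm_val M e s) (tm_val M e t)"
| "tm_val M e (Times s t) = Mul M (tm_val M e s) (tm_val M e t)"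

primrec sat :: "'m l2_structure \<Rightarrow> (nat \<Rightarrow> 'm) \<Rightarrow> (nat \<Rightarrow> 'm set) \<Rightarrow> form \<Rightarrow> bool" where
  "sat M e E (Eq s t) \<longleftrightarrow> tm_val M e s = tm_val M e t"
| "sat M e E (Less s t) \<longleftrightarrow> Lt M (tm_val M e s) (tm_val M e t)"
| "sat M e E (Mem t X) \<longleftrightarrow> tm_val M e t \<in> E X"
| "sat M e E (Neg p) \<longleftrightarrow> \<not> sat M e E p"
| "sat M e E (And p q) \<longleftrightarrow> sat M e E p \<and> sat M e E q"
| "sat M e E (Or p q) \<longleftrightarrow> sat M e E p \<or> sat M e E q"
| "sat M e E (Imp p q) \<longleftrightarrow> (sat M e E p \<longrightarrow> sat M e E q)"
| "sat M e E (Iff p q) \<longleftrightarrow> (sat M e E p \<longleftrightarrow> sat M e E q)"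
| "sat M e E (AllN x p) \<longleftrightarrow> (\<forall>a. sat M (e(x := a)) E p)"
| "sat M e E (ExN x p) \<longleftrightarrow> (\<exists>a. sat M (e(x := a)) E p)"
| "sat M e E (AllS X p) \<longleftrightarrow> (\<forall>A\<in>Sets M. sat M e (E(X := A)) p)"
| "sat M e E (ExS X p) \<longleftrightarrow> (\<exists>A\<in>Sets M. sat M e (E(X := A)) p)"


section \<open>Formula classes\<close>

inductive Sigma00 :: "form \<Rightarrow> bool" where
  "Sigma00 (Eq s t)"
| "Sigma00 (Less s t)"
| "Sigma00 (Mem t X)"
| "Sigma00 p \<Longrightarrow> Sigma00 (Neg p)"
| "Sigma00 p \<Longrightarrow> Sigma00 q \<Longrightarrow> Sigma00 (And p q)"
| "Sigma00 p \<Longrightarrow> Sigma00 q \<Longrightarrow> Sigma00 (Or p q)"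
| "Sigma00 p \<Longrightarrow> Sigma00 q \<Longrightarrow> Sigma00 (Imp p q)"
| "Sigma00 p \<Longrightarrow> Sigma00 q \<Longrightarrow> Sigma00 (Iff p q)"
| "Sigma00 p \<Longrightarrow> x \<notin> tm_vars t \<Longrightarrow> Sigma00 (AllN x (Imp (Less (Var x) t) p))"
| "Sigma00 p \<Longrightarrow> x \<notin> tm_vars t \<Longrightarrow> Sigma00 (ExN x (And (Less (Var x) t) p))"

inductive Sigma01 :: "form \<Rightarrow> bool" where
  "Sigma00 p \<Longrightarrow> Sigma01 (ExN x p)"

inductive Pi01 :: "form \<Rightarrow> bool" where
  "Sigma00 p \<Longrightarrow> Pi01 (AllN x p)"

primrec arithmetical :: "form \<Rightarrow> bool" where
  "arithmetical (Eq s t) = True"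
| "arithmetical (Less s t) = True"
| "arithmetical (Mem t X) = True"
| "arithmetical (Neg p) = arithmetical p"
| "arithmetical (And p q) = (arithmetical p \<and> arithmetical q)"
| "arithmetical (Or p q) = (arithmetical p \<and> arithmetical q)"
| "arithmetical (Imp p q) = (arithmetical p \<and> arithmetical q)"
| "arithmetical (Iff p q) = (arithmetical p \<and> arithmetical q)"
| "arithmetical (AllN x p) = arithmetical p"
| "arithmetical (ExN x p) = arithmetical p"
| "arithmetical (AllS X p) = False"
| "arithmetical (ExS X p) = False"

inductive Pi11 :: "form \<Rightarrow> bool" where
  "arithmetical p \<Longrightarrow> Pi11 (AllS X p)"


section \<open>The axiom systems\<close>

definition basic_axioms :: "'m l2_structure \<Rightarrow> bool" where
  "basic_axioms M \<longleftrightarrow>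
     (\<forall>n. Add M n (One M) \<noteq> Zero M) \<and>
     (\<forall>m n. Add M m (One M) = Add M n (One M) \<longrightarrow> m = n) \<and>
     (\<forall>m. Add M m (Zero M) = m) \<and>
     (\<forall>m n. Add M m (Add M n (One M)) = Add M (Add M m n) (One M)) \<and>
     (\<forall>m. Mul M m (Zero M) = Zero M) \<and>
     (\<forall>m n. Mul M m (Add M n (One M)) = Add M (Mul M m n) m) \<and>
     (\<forall>m. \<not> Lt M m (Zero M)) \<and>
     (\<forall>m n. Lt M m (Add M n (One M)) \<longleftrightarrow> Lt M m n \<or> m = n)"

text \<open>
  An axiom scheme holds in \<open>M\<close> if the universal closures of its instances do. The assignments \<open>e\<close>
  and \<open>E\<close> supply the number and set parameters; assigning a value to \<open>x\<close> plays the role of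
  substituting a term for the distinguished variable \<open>x\<close>.
\<close>

definition Sigma01_induction :: "'m l2_structure \<Rightarrow> bool" where
  "Sigma01_induction M \<longleftrightarrow>
     (\<forall>p x e E. Sigma01 p \<longrightarrow> range E \<subseteq> Sets M \<longrightarrow>
        sat M (e(x := Zero M)) E p \<longrightarrow>
        (\<forall>n. sat M (e(x := n)) E p \<longrightarrow> sat M (e(x := Add M n (One M))) E p) \<longrightarrow>
        (\<forall>n. sat M (e(x := n)) E p))"

definition Delta01_comprehension :: "'m l2_structure \<Rightarrow> bool" where
  "Delta01_comprehension M \<longleftrightarrow>
     (\<forall>p q x e E. Sigma01 p \<longrightarrow> Pi01 q \<longrightarrow> range E \<subseteq> Sets M \<longrightarrow>
        (\<forall>n. sat M (e(x := n)) E p \<longleftrightarrow> sat M (e(x := n)) E q) \<longrightarrow>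
        (\<exists>A\<in>Sets M. \<forall>n. n \<in> A \<longleftrightarrow> sat M (e(x := n)) E p))"

definition Pi11_comprehension :: "'m l2_structure \<Rightarrow> bool" where
  "Pi11_comprehension M \<longleftrightarrow>
     (\<forall>p x e E. Pi11 p \<longrightarrow> range E \<subseteq> Sets M \<longrightarrow>
        (\<exists>A\<in>Sets M. \<forall>n. n \<in> A \<longleftrightarrow> sat M (e(x := n)) E p))"

definition RCA0 :: "'m l2_structure \<Rightarrow> bool" where
  "RCA0 M \<longleftrightarrow> Sets M \<noteq> {} \<and> basic_axioms M \<and> Sigma01_induction M \<and> Delta01_comprehension M"

definition Pi11_CA0 :: "'m l2_structure \<Rightarrow> bool" where
  "Pi11_CA0 M \<longleftrightarrow> RCA0 M \<and> Pi11_comprehension M"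


section \<open>Coding inside a structure\<close>

text \<open>The pairing map \<open>(i, j) = (i + j)\<^sup>2 + i\<close>; it is injective in every model of \<open>RCA\<^sub>0\<close>.\<close>

definition pair :: "'m l2_structure \<Rightarrow> 'm \<Rightarrow> 'm \<Rightarrow> 'm" where
  "pair M i j = Add M (Mul M (Add M i j) (Add M i j)) i"

text \<open>A set \<open>X\<close> codes the sequence of sets whose \<open>i\<close>-th term is \<open>column M X i\<close>.\<close>

definition column :: "'m l2_structure \<Rightarrow> 'm set \<Rightarrow> 'm \<Rightarrow> 'm set" where
  "column M X i = {n. pair M n i \<in> X}"

text \<open>\<open>numer M k\<close> is the value of the numeral \<open>k\<close>, and \<open>below M k\<close> is \<open>{0, \<dots>, k - 1}\<close>.\<close>

primrec numer :: "'m l2_structure \<Rightarrow> nat \<Rightarrow> 'm" where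
  "numer M 0 = Zero M"
| "numer M (Suc k) = Add M (numer M k) (One M)"

definition below :: "'m l2_structure \<Rightarrow> nat \<Rightarrow> 'm set" where
  "below M k = {a. Lt M a (numer M k)}"

text \<open>\<open>f\<close> is a function of the structure, i.e. a graph belonging to \<open>Sets M\<close>, from \<open>X\<close> to \<open>Y\<close>.\<close>

definition is_fun :: "'m l2_structure \<Rightarrow> 'm set \<Rightarrow> 'm set \<Rightarrow> 'm set \<Rightarrow> bool" where
  "is_fun M f X Y \<longleftrightarrow>
     f \<in> Sets M \<and>
     (\<forall>p\<in>f. \<exists>x\<in>X. \<exists>y\<in>Y. p = pair M x y) \<and>
     (\<forall>x\<in>X. \<exists>!y. pair M x y \<in> f)"

definition app :: "'m l2_structure \<Rightarrow> 'm set \<Rightarrow> 'm \<Rightarrow> 'm" where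
  "app M f x = (THE y. pair M x y \<in> f)"


section \<open>Hypergraphs and colorings\<close>

text \<open>
  A hypergraph is presented by its vertex set and the sequence of its edges. The edges are indexed
  by an arbitrary set of numbers, so that there may be infinitely many, finitely many or no edges;
  the edge with index \<open>j\<close> is the \<open>j\<close>-th column of \<open>Inc\<close>.
\<close>

record 'm hypergraph =
  Vert :: "'m set"
  Idx :: "'m set"
  Inc :: "'m set"

definition edges :: "'m l2_structure \<Rightarrow> 'm hypergraph \<Rightarrow> 'm set set" where
  "edges M H = (\<lambda>j. column M (Inc H) j) ` Idx H"

definition is_hypergraph :: "'m l2_structure \<Rightarrow> 'm hypergraph \<Rightarrow> bool" where
  "is_hypergraph M H \<longleftrightarrow>
     Vert H \<in> Sets M \<and> Idx H \<in> Sets M \<and> Inc H \<in> Sets M \<and> (\<forall>e\<in>edges M H. e \<subseteq> Vert H)"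

text \<open>A sequence of hypergraphs is coded by three sets, each coding a sequence of sets.\<close>

definition hyp_at :: "'m l2_structure \<Rightarrow> 'm hypergraph \<Rightarrow> 'm \<Rightarrow> 'm hypergraph" where
  "hyp_at M H i =
     \<lparr>Vert = column M (Vert H) i, Idx = column M (Idx H) i, Inc = column M (Inc H) i\<rparr>"

definition is_hypergraph_seq :: "'m l2_structure \<Rightarrow> 'm hypergraph \<Rightarrow> bool" where
  "is_hypergraph_seq M H \<longleftrightarrow>
     Vert H \<in> Sets M \<and> Idx H \<in> Sets M \<and> Inc H \<in> Sets M \<and> (\<forall>i. is_hypergraph M (hyp_at M H i))"

definition is_coloring :: "'m l2_structure \<Rightarrow> nat \<Rightarrow> 'm hypergraph \<Rightarrow> 'm set \<Rightarrow> bool" where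
  "is_coloring M k H \<chi> \<longleftrightarrow> is_fun M \<chi> (Vert H) (below M k)"

definition proper :: "'m l2_structure \<Rightarrow> 'm hypergraph \<Rightarrow> 'm set \<Rightarrow> bool" where
  "proper M H \<chi> \<longleftrightarrow>
     (\<forall>e\<in>edges M H. (\<exists>u\<in>e. \<exists>v\<in>e. u \<noteq> v) \<longrightarrow> (\<exists>u\<in>e. \<exists>v\<in>e. app M \<chi> u \<noteq> app M \<chi> v))"

definition conflict_free :: "'m l2_structure \<Rightarrow> 'm hypergraph \<Rightarrow> 'm set \<Rightarrow> bool" where
  "conflict_free M H \<chi> \<longleftrightarrow> (\<forall>e\<in>edges M H. \<exists>j. \<exists>!v. v \<in> e \<and> app M \<chi> v = j)"

definition proper_coloring_principle :: "'m l2_structure \<Rightarrow> nat \<Rightarrow> bool" where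
  "proper_coloring_principle M k \<longleftrightarrow>
     (\<forall>H. is_hypergraph_seq M H \<longrightarrow>
        (\<exists>f. is_fun M f UNIV (below M 2) \<and>
             (\<forall>i. app M f i = One M \<longleftrightarrow>
                  (\<exists>\<chi>. is_coloring M k (hyp_at M H i) \<chi> \<and> proper M (hyp_at M H i) \<chi>))))"

definition conflict_free_coloring_principle :: "'m l2_structure \<Rightarrow> nat \<Rightarrow> bool" where
  "conflict_free_coloring_principle M k \<longleftrightarrow>
     (\<forall>H. is_hypergraph_seq M H \<longrightarrow>
        (\<exists>f. is_fun M f UNIV (below M 2) \<and>
             (\<forall>i. app M f i = One M \<longleftrightarrow>
                  (\<exists>\<chi>. is_coloring M k (hyp_at M H i) \<chi> \<and> conflict_free M (hyp_at M H i) \<chi>))))"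

end

theory Submission
  imports Defs "HOL-Library.Countable"
begin

text \<open>
  A comprehension instance for the \<open>\<Sigma>\<^sup>1\<^sub>1\<close> formula ``there is a coloring'' gives both coloring principles.
  Conversely, a hypergraph sequence whose \<open>n\<close>-th member contains a copy of the complete graph on
  \<open>k + 1\<close> vertices for each witness of \<open>\<exists>x. (x, n) \<in> A\<close> yields arithmetical comprehension.
  For an arithmetical \<open>\<theta>\<close>, the truth values of all instances of the subformulas of \<open>\<theta>(X)\<close> form a
  network of infinitary NOR gates. A consistent valuation of such a network is a kernel of the digraph
  of its wires, and in the presence of arithmetical comprehension \<open>\<exists>X. \<theta>(X)\<close> holds iff this digraph
  has a kernel containing the output node. Finally, for every digraph and node there is one
  hypergraph for which a proper \<open>k\<close>-coloring yields a kernel containing the node, and such a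
  kernel yields a conflict-free \<open>k\<close>-coloring; as conflict-free colorings are proper, it serves both
  principles.
\<close>

section \<open>Formulas and assignments\<close>

text \<open>The numbers of \<open>M\<close> may be nonstandard, while k and all formulas are
  standard. Whatever depends on k or on the shape of a formula (pigeonhole, finite unions, tuples of
  values, evaluation of gates) is therefore done by induction outside the model; inside, induction
  for members of \<open>Sets M\<close> suffices. The network takes the place of a normal form for
  \<open>\<Sigma>\<^sup>1\<^sub>1\<close> formulas: the kernel condition is local, so neither Skolem
  functions nor a choice principle is called for in the model. Passing from kernels to edges has one
  delicate point. That a member of the kernel has no input in it is a condition on pairs of nodes,
  but that every other node has such an input is a possibly infinite disjunction, hence a possibly
  infinite edge. Properness of this edge gives the disjunction; conflict-freeness also demands a
  color that occurs once, so a kernel must designate exactly one input. The least one is taken.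
  Arithmetical comprehension has to come first, because the digraph and the valuation of its nodes
  are arithmetically defined.\<close>

lemma tm_vars_finite: "finite (tm_vars t)"
  by (induction t) auto

lemma tm_val_agree: "(\<And>i. i \<in> tm_vars t \<Longrightarrow> e i = e' i) \<Longrightarrow> tm_val M e t = tm_val M e' t"
  by (induction t) auto

lemma tm_val_agree_below:
  assumes "tm_vars t \<subseteq> {..<n}" "\<And>i. i < n \<Longrightarrow> e i = e' i"
  shows "tm_val M e t = tm_val M e' t"
  using assms by (intro tm_val_agree) blast

lemma tm_vars_bounded: "\<exists>n. tm_vars t \<subseteq> {..<n}"
  using tm_vars_finite[of t] finite_nat_set_iff_bounded by (metis lessThan_iff subsetI)

lemma agree_below_max:
  assumes "\<exists>m. \<forall>e e' E. (\<forall>i<m. e i = e' i) \<longrightarrow> P e E = P e' E"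
    and "\<exists>m. \<forall>e e' E. (\<forall>i<m. e i = e' i) \<longrightarrow> Q e E = Q e' E"
  shows "\<exists>m::nat. \<forall>e e' E. (\<forall>i<m. e i = e' i) \<longrightarrow> P e E = P e' E \<and> Q e E = Q e' E"
proof -
  obtain m n where m: "\<And>e e' E. \<forall>i<m. e i = e' i \<Longrightarrow> P e E = P e' E"
    and n: "\<And>e e' E. \<forall>i<n. e i = e' i \<Longrightarrow> Q e E = Q e' E"
    using assms by blast
  show ?thesis
    by (intro exI[of _ "max m n"] allI impI conjI m n) simp_all
qed

lemma tm_val_agree_ex: "\<exists>m. \<forall>e e' E. (\<forall>i<m. e i = e' i) \<longrightarrow> tm_val M e t = tm_val M e' t"
proof -
  obtain m where "tm_vars t \<subseteq> {..<m}" using tm_vars_bounded by blast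
  then show ?thesis using tm_val_agree_below by blast
qed

text \<open>Takes the place of a computation of free variables: every index from m on is fresh, and
  the first m values of an assignment are all that a code has to remember. The bound is uniform in
  the set assignment.\<close>

lemma sat_agree_below:
  fixes M :: "'m l2_structure"
  shows "\<exists>m. \<forall>e e' E. (\<forall>i<m. e i = e' i) \<longrightarrow> sat M e E p = sat M e' E p"
proof (induction p)
  case (Eq s t)
  show ?case
    using agree_below_max[OF tm_val_agree_ex[of M s] tm_val_agree_ex[of M t]] unfolding sat.simps by metis
next
  case (Less s t)
  show ?case
    using agree_below_max[OF tm_val_agree_ex[of M s] tm_val_agree_ex[of M t]] unfolding sat.simps by metis
next
  case (Mem t X)
  show ?case
    using tm_val_agree_ex[of M t] by simp metis
next
  case (Neg p)
  then show ?case unfolding sat.simps by metis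
next
  case (And p q)
  show ?case using agree_below_max[OF And.IH] unfolding sat.simps by metis
next
  case (Or p q)
  show ?case using agree_below_max[OF Or.IH] unfolding sat.simps by metis
next
  case (Imp p q)
  show ?case using agree_below_max[OF Imp.IH] unfolding sat.simps by metis
next
  case (Iff p q)
  show ?case using agree_below_max[OF Iff.IH] unfolding sat.simps by metis
next
  case (AllN x p)
  then obtain m where m: "\<And>e e' E. (\<forall>i<m. e i = e' i) \<Longrightarrow> sat M e E p = sat M e' E p" by blast
  have "sat M (e(x := a)) E p = sat M (e'(x := a)) E p" if "\<forall>i<m. e i = e' i" for e e' E a
    by (rule m) (use that in simp)
  then have "\<forall>e e' E. (\<forall>i<m. e i = e' i) \<longrightarrow> sat M e E (AllN x p) = sat M e' E (AllN x p)"
    unfolding sat.simps by blast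
  then show ?case by blast
next
  case (ExN x p)
  then obtain m where m: "\<And>e e' E. (\<forall>i<m. e i = e' i) \<Longrightarrow> sat M e E p = sat M e' E p" by blast
  have "sat M (e(x := a)) E p = sat M (e'(x := a)) E p" if "\<forall>i<m. e i = e' i" for e e' E a
    by (rule m) (use that in simp)
  then have "\<forall>e e' E. (\<forall>i<m. e i = e' i) \<longrightarrow> sat M e E (ExN x p) = sat M e' E (ExN x p)"
    unfolding sat.simps by blast
  then show ?case by blast
next
  case (AllS X p)
  then obtain m where "\<And>e e' E. (\<forall>i<m. e i = e' i) \<Longrightarrow> sat M e E p = sat M e' E p" by blast
  then have "\<forall>e e' E. (\<forall>i<m. e i = e' i) \<longrightarrow> sat M e E (AllS X p) = sat M e' E (AllS X p)"
    unfolding sat.simps by blast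
  then show ?case by blast
next
  case (ExS X p)
  then obtain m where "\<And>e e' E. (\<forall>i<m. e i = e' i) \<Longrightarrow> sat M e E p = sat M e' E p" by blast
  then have "\<forall>e e' E. (\<forall>i<m. e i = e' i) \<longrightarrow> sat M e E (ExS X p) = sat M e' E (ExS X p)"
    unfolding sat.simps by blast
  then show ?case by blast
qed

text \<open>A block of quantifiers over the variables below n that share the bound held by variable
  b. As long as n \<le> b, no quantifier of the block captures the bound.\<close>

fun bexs :: "nat \<Rightarrow> nat \<Rightarrow> form \<Rightarrow> form" where
  "bexs b 0 p = p"
| "bexs b (Suc n) p = ExN n (And (Less (Var n) (Plus (Var b) On)) (bexs b n p))"

lemma Sigma00_bexs: "n \<le> b \<Longrightarrow> Sigma00 p \<Longrightarrow> Sigma00 (bexs b n p)"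
  by (induction n) (auto intro: Sigma00.intros)

lemma sat_bexs:
  "n \<le> b \<Longrightarrow> sat M e E (bexs b n p) \<longleftrightarrow>
    (\<exists>v. (\<forall>i\<ge>n. v i = e i) \<and> (\<forall>i<n. Lt M (v i) (Add M (e b) (One M))) \<and> sat M v E p)"
proof (induction n arbitrary: e)
  case 0
  have "v = e" if "\<forall>i. v i = e i" for v using that by auto
  then show ?case by auto
next
  case (Suc n)
  have *: "sat M (e(n := a)) E (bexs b n p) \<longleftrightarrow> (\<exists>v. (\<forall>i\<ge>Suc n. v i = e i) \<and> v n = a \<and>
      (\<forall>i<n. Lt M (v i) (Add M (e b) (One M))) \<and> sat M v E p)" for a
    using Suc.prems by (subst Suc.IH) (auto simp: le_eq_less_or_eq[of n] Suc_le_eq)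
  show ?case using Suc.prems by (auto simp: * less_Suc_eq)
qed

fun exs :: "nat \<Rightarrow> form \<Rightarrow> form" where
  "exs 0 p = p"
| "exs (Suc n) p = ExN n (exs n p)"

lemma arithmetical_exs: "arithmetical p \<Longrightarrow> arithmetical (exs n p)"
  by (induction n) auto

lemma sat_exs:
  "sat M e E (exs n p) \<longleftrightarrow> (\<exists>v. (\<forall>i\<ge>n. v i = e i) \<and> sat M v E p)"
proof (induction n arbitrary: e)
  case 0
  have "v = e" if "\<forall>i. v i = e i" for v using that by auto
  then show ?case by auto
next
  case (Suc n)
  have *: "sat M (e(n := a)) E (exs n p) \<longleftrightarrow> (\<exists>v. (\<forall>i\<ge>Suc n. v i = e i) \<and> v n = a \<and> sat M v E p)" for a
    by (subst Suc.IH) (auto simp: le_eq_less_or_eq[of n] Suc_le_eq)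
  show ?case by (auto simp: *)
qed

section \<open>Terms for numerals and pairs\<close>

primrec tnum :: "nat \<Rightarrow> tm" where
  "tnum 0 = Zer"
| "tnum (Suc n) = Plus (tnum n) On"

lemma tm_val_tnum [simp]: "tm_val M e (tnum n) = numer M n"
  by (induction n) auto

lemma tm_vars_tnum [simp]: "tm_vars (tnum n) = {}"
  by (induction n) auto

definition tpair :: "tm \<Rightarrow> tm \<Rightarrow> tm" where
  "tpair s t = Plus (Times (Plus s t) (Plus s t)) s"

lemma tm_val_tpair [simp]: "tm_val M e (tpair s t) = pair M (tm_val M e s) (tm_val M e t)"
  by (simp add: tpair_def pair_def)

lemma tm_vars_tpair [simp]: "tm_vars (tpair s t) = tm_vars s \<union> tm_vars t"
  by (auto simp add: tpair_def)

section \<open>Arithmetic in models of \<open>RCA\<^sub>0\<close>\<close>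

locale rca0 =
  fixes M :: "'m l2_structure"
  assumes RCA0: "RCA0 M"
begin

abbreviation zero ("\<zero>") where "\<zero> \<equiv> Zero M"
abbreviation one ("\<one>") where "\<one> \<equiv> One M"
abbreviation add (infixl "\<oplus>" 65) where "a \<oplus> b \<equiv> Add M a b"
abbreviation mul (infixl "\<otimes>" 70) where "a \<otimes> b \<equiv> Mul M a b"
abbreviation lt (infix "\<prec>" 50) where "a \<prec> b \<equiv> Lt M a b"
abbreviation le (infix "\<preceq>" 50) where "a \<preceq> b \<equiv> Lt M a (Add M b (One M))"
abbreviation prd ("\<langle>_,/ _\<rangle>") where "\<langle>a, b\<rangle> \<equiv> pair M a b"

lemma suc_neq_0 [simp]: "a \<oplus> \<one> \<noteq> \<zero>"
  and suc_inj [simp]: "a \<oplus> \<one> = b \<oplus> \<one> \<longleftrightarrow> a = b"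
  and add_0 [simp]: "a \<oplus> \<zero> = a"
  and add_suc: "a \<oplus> (b \<oplus> \<one>) = a \<oplus> b \<oplus> \<one>"
  and mul_0 [simp]: "a \<otimes> \<zero> = \<zero>"
  and mul_suc: "a \<otimes> (b \<oplus> \<one>) = a \<otimes> b \<oplus> a"
  and not_lt_0 [simp]: "\<not> a \<prec> \<zero>"
  and lt_suc: "a \<preceq> b \<longleftrightarrow> a \<prec> b \<or> a = b"
  using RCA0 unfolding RCA0_def basic_axioms_def by blast+

text \<open>A vacuous quantifier over a fresh variable turns p into a \<open>Sigma01\<close> formula
  and equally into a \<open>Pi01\<close> formula.\<close>

lemma Sigma00_comprehension:
  assumes "Sigma00 p" "\<And>n. E n \<in> Sets M"
  shows "{n. sat M (e(x := n)) E p} \<in> Sets M"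
proof -
  obtain m where m: "\<forall>e e' E. (\<forall>i<m. e i = e' i) \<longrightarrow> sat M e E p = sat M e' E p"
    using sat_agree_below by blast
  have *: "sat M (e(m := a)) E p = sat M e E p" for e a
    using m by (metis fun_upd_other less_irrefl)
  have "Sigma01 (ExN m p)" "Pi01 (AllN m p)" "range E \<subseteq> Sets M"
    using assms by (auto intro: Sigma01.intros Pi01.intros)
  moreover have "sat M (e(x := n)) E (ExN m p) = sat M (e(x := n)) E (AllN m p)" for n
    by (simp add: *)
  moreover have "Delta01_comprehension M" using RCA0 by (simp add: RCA0_def)
  ultimately have "\<exists>A\<in>Sets M. \<forall>n. n \<in> A \<longleftrightarrow> sat M (e(x := n)) E (ExN m p)"
    unfolding Delta01_comprehension_def by (metis (no_types, lifting))
  then obtain A where "A \<in> Sets M" "\<forall>n. n \<in> A \<longleftrightarrow> sat M (e(x := n)) E (ExN m p)"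
    by blast
  moreover from this have "{n. sat M (e(x := n)) E p} = A" by (auto simp: *)
  ultimately show ?thesis by simp
qed

lemma some_set: "\<exists>A. A \<in> Sets M"
  using RCA0 by (auto simp: RCA0_def)

text \<open>All induction inside the model goes through this case. The quantifier over variable 1 is
  vacuous and only brings the formula into the shape \<open>Sigma01\<close>.\<close>

lemma set_induct:
  assumes "A \<in> Sets M" "\<zero> \<in> A" "\<And>n. n \<in> A \<Longrightarrow> n \<oplus> \<one> \<in> A"
  shows "n \<in> A"
proof -
  have S: "Sigma01 (ExN 1 (Mem (Var 0) 0))" by (auto intro: Sigma01.intros Sigma00.intros)
  have I: "Sigma01_induction M" using RCA0 by (simp add: RCA0_def)
  have R: "range (\<lambda>_::nat. A) \<subseteq> Sets M" using assms by auto
  have "sat M ((\<lambda>_. \<zero>)(0 := n)) (\<lambda>_. A) (ExN 1 (Mem (Var 0) 0))"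
    by (rule I[unfolded Sigma01_induction_def, rule_format, OF S R]) (use assms(2,3) in auto)
  then show ?thesis by simp
qed

text \<open>Meant for formulas without set variables; the set assignment is then an arbitrary
  constant, chosen in \<open>Sets M\<close> because comprehension asks for that.\<close>

lemma Sigma00_induct:
  assumes "Sigma00 p"
    and "sat M (e(x := \<zero>)) (\<lambda>_. SOME A. A \<in> Sets M) p"
    and "\<And>n. sat M (e(x := n)) (\<lambda>_. SOME A. A \<in> Sets M) p \<Longrightarrow>
             sat M (e(x := n \<oplus> \<one>)) (\<lambda>_. SOME A. A \<in> Sets M) p"
  shows "sat M (e(x := n)) (\<lambda>_. SOME A. A \<in> Sets M) p"
proof -
  have "(SOME A. A \<in> Sets M) \<in> Sets M" using some_set by (rule someI_ex)
  then show ?thesis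
    using set_induct[OF Sigma00_comprehension[OF assms(1)], of "\<lambda>_. SOME A. A \<in> Sets M" e x n]
      assms by auto
qed

lemma eq_induct:
  assumes "tm_val M (e(0 := \<zero>)) s = tm_val M (e(0 := \<zero>)) t"
    and "\<And>n. tm_val M (e(0 := n)) s = tm_val M (e(0 := n)) t \<Longrightarrow>
         tm_val M (e(0 := n \<oplus> \<one>)) s = tm_val M (e(0 := n \<oplus> \<one>)) t"
  shows "tm_val M (e(0 := n)) s = tm_val M (e(0 := n)) t"
  using Sigma00_induct[of "Eq s t" e 0 n] assms by (auto intro: Sigma00.intros)

section \<open>Laws of addition and multiplication, with variable 0 as the induction
  variable\<close>

lemma add_assoc: "a \<oplus> b \<oplus> c = a \<oplus> (b \<oplus> c)"
  using eq_induct[of "\<lambda>n. if n = 1 then a else b"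
      "Plus (Plus (Var 1) (Var 2)) (Var 0)" "Plus (Var 1) (Plus (Var 2) (Var 0))" c]
  by (simp add: add_suc)

lemma add_0_left [simp]: "\<zero> \<oplus> a = a"
  using eq_induct[of "\<lambda>n. a" "Plus Zer (Var 0)" "Var 0" a]
  by (simp add: add_suc)

lemma add_suc_left: "a \<oplus> \<one> \<oplus> b = a \<oplus> b \<oplus> \<one>"
  using eq_induct[of "\<lambda>n. a" "Plus (Plus (Var 1) On) (Var 0)" "Plus (Plus (Var 1) (Var 0)) On" b]
  by (simp add: add_suc)

lemma add_commute: "a \<oplus> b = b \<oplus> a"
  using eq_induct[of "\<lambda>n. a" "Plus (Var 1) (Var 0)" "Plus (Var 0) (Var 1)" b]
  by (simp add: add_suc add_suc_left)

lemma add_left_commute: "a \<oplus> (b \<oplus> c) = b \<oplus> (a \<oplus> c)"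
  by (metis add_assoc add_commute)

lemmas add_ac = add_assoc add_commute add_left_commute

lemma mul_0_left [simp]: "\<zero> \<otimes> a = \<zero>"
  using eq_induct[of "\<lambda>n. a" "Times Zer (Var 0)" Zer a]
  by (simp add: mul_suc)

lemma mul_suc_left: "(a \<oplus> \<one>) \<otimes> b = a \<otimes> b \<oplus> b"
  using eq_induct[of "\<lambda>n. a" "Times (Plus (Var 1) On) (Var 0)" "Plus (Times (Var 1) (Var 0)) (Var 0)" b]
  by (simp add: mul_suc add_ac)

lemma mul_commute: "a \<otimes> b = b \<otimes> a"
  using eq_induct[of "\<lambda>n. a" "Times (Var 1) (Var 0)" "Times (Var 0) (Var 1)" b]
  by (simp add: mul_suc mul_suc_left)

lemma distrib_left: "a \<otimes> (b \<oplus> c) = a \<otimes> b \<oplus> a \<otimes> c"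
  using eq_induct[of "\<lambda>n. if n = 1 then a else b"
      "Times (Var 1) (Plus (Var 2) (Var 0))" "Plus (Times (Var 1) (Var 2)) (Times (Var 1) (Var 0))" c]
  by (simp add: add_suc mul_suc add_assoc[of _ _ a])

lemma distrib_right: "(b \<oplus> c) \<otimes> a = b \<otimes> a \<oplus> c \<otimes> a"
  by (metis distrib_left mul_commute)

lemma add_right_cancel [simp]: "a \<oplus> c = b \<oplus> c \<longleftrightarrow> a = b"
  using Sigma00_induct[of "Imp (Eq (Plus (Var 1) (Var 0)) (Plus (Var 2) (Var 0))) (Eq (Var 1) (Var 2))"
      "\<lambda>n. if n = 1 then a else b" 0 c]
  by (auto simp add: add_suc intro: Sigma00.intros)

lemma add_left_cancel [simp]: "c \<oplus> a = c \<oplus> b \<longleftrightarrow> a = b"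
  by (metis add_commute add_right_cancel)

section \<open>The order\<close>

lemma zero_lt_one [simp]: "\<zero> \<prec> \<one>"
  using lt_suc[of \<zero> \<zero>] by simp

lemma zero_le [simp]: "\<zero> \<preceq> a"
  using Sigma00_induct[of "Less Zer (Plus (Var 0) On)" "\<lambda>n. a" 0 a]
  by (auto simp: lt_suc[of _ "_ \<oplus> \<one>"] lt_suc[of _ \<zero>] intro: Sigma00.intros)

text \<open>The predecessor is sought below the number itself, which keeps the induction formula
  \<open>Sigma00\<close>. The differences in \<open>lt_imp_add\<close> are bounded for the same
  reason.\<close>

lemma zero_or_suc: "a = \<zero> \<or> (\<exists>b. a = b \<oplus> \<one>)"
proof -
  have "sat M ((\<lambda>_. a)(0 := n)) (\<lambda>_. SOME A. A \<in> Sets M)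
    (Or (Eq (Var 0) Zer) (ExN 1 (And (Less (Var 1) (Var 0)) (Eq (Var 0) (Plus (Var 1) On)))))" for n
    by (rule Sigma00_induct) (auto simp: lt_suc intro!: Sigma00.intros)
  from this[of a] show ?thesis by auto
qed

lemma suc_le:
  assumes "a \<prec> b" shows "a \<oplus> \<one> \<preceq> b"
proof -
  have "sat M ((\<lambda>_. a)(0 := n)) (\<lambda>_. SOME A. A \<in> Sets M)
     (Imp (Less (Var 1) (Var 0)) (Less (Plus (Var 1) On) (Plus (Var 0) On)))" for n
    by (rule Sigma00_induct) (auto simp: lt_suc[of _ "_ \<oplus> \<one>"] lt_suc[of a] intro!: Sigma00.intros)
  from this[of b] assms show ?thesis by auto
qed

lemma lt_imp_add:
  assumes "a \<prec> b" shows "\<exists>d. b = a \<oplus> d \<oplus> \<one>"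
proof -
  have "sat M ((\<lambda>_. a)(0 := n)) (\<lambda>_. SOME A. A \<in> Sets M)
    (Imp (Less (Var 1) (Var 0))
       (ExN 2 (And (Less (Var 2) (Var 0)) (Eq (Var 0) (Plus (Plus (Var 1) (Var 2)) On)))))" for n
  proof (rule Sigma00_induct, goal_cases)
    case (3 n)
    have "\<exists>d. d \<preceq> n \<and> n = a \<oplus> d" if le: "a \<preceq> n"
    proof (cases "a = n")
      case True
      then show ?thesis by (intro exI[of _ \<zero>]) simp
    next
      case False
      with le 3 obtain d where "d \<prec> n" "n = a \<oplus> d \<oplus> \<one>" by (auto simp: lt_suc)
      then show ?thesis by (intro exI[of _ "d \<oplus> \<one>"]) (simp add: suc_le add_suc)
    qed
    then show ?case by auto
  qed (auto intro!: Sigma00.intros)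
  from this[of b] assms show ?thesis by auto
qed

lemma le_add [simp]: "a \<preceq> a \<oplus> d"
  using Sigma00_induct[of "Less (Var 1) (Plus (Plus (Var 1) (Var 0)) On)" "\<lambda>n. a" 0 d]
  by (auto simp: lt_suc[of a "a \<oplus> _ \<oplus> \<one>"] lt_suc[of a a] add_suc intro: Sigma00.intros)

lemma lt_iff: "a \<prec> b \<longleftrightarrow> (\<exists>d. b = a \<oplus> d \<oplus> \<one>)"
  using lt_imp_add le_add by auto

lemma le_iff: "a \<preceq> b \<longleftrightarrow> (\<exists>d. b = a \<oplus> d)"
  by (simp add: lt_iff)

lemma le_refl [simp]: "a \<preceq> a"
  using lt_suc by blast

lemma le_trans: "a \<preceq> b \<Longrightarrow> b \<preceq> c \<Longrightarrow> a \<preceq> c"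
  unfolding le_iff by (metis add_assoc)

lemma lt_irrefl [simp]: "\<not> a \<prec> a"
  by (metis add_0 add_left_cancel add_suc lt_iff suc_neq_0)

lemma lt_linear: "a \<prec> b \<or> a = b \<or> b \<prec> a"
proof -
  have "sat M ((\<lambda>_. a)(0 := n)) (\<lambda>_. SOME A. A \<in> Sets M)
     (Or (Less (Var 1) (Var 0)) (Or (Eq (Var 1) (Var 0)) (Less (Var 0) (Var 1))))" for n
  proof (rule Sigma00_induct, goal_cases)
    case 2
    then show ?case using zero_le[of a] by (auto simp: lt_suc)
  next
    case (3 n)
    then show ?case using suc_le[of n a] by (auto simp: lt_suc)
  qed (auto intro!: Sigma00.intros)
  from this[of b] show ?thesis by auto
qed

lemma lt_trans: "a \<prec> b \<Longrightarrow> b \<prec> c \<Longrightarrow> a \<prec> c"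
  unfolding lt_iff by (metis add_assoc)

section \<open>Injectivity of the pairing map\<close>

lemma le_square: "a \<preceq> a \<otimes> a"
proof (cases "a = \<zero>")
  case False
  then obtain b where "a = b \<oplus> \<one>" using zero_or_suc by blast
  then have "a \<otimes> a = a \<oplus> a \<otimes> b" by (simp add: mul_suc add_ac)
  then show ?thesis by simp
qed simp

lemma le_pair_left [simp]: "a \<preceq> \<langle>a, b\<rangle>"
  by (metis add_commute le_add pair_def)

lemma le_pair_right [simp]: "b \<preceq> \<langle>a, b\<rangle>"
proof -
  have "b \<preceq> a \<oplus> b" by (metis add_commute le_add)
  moreover have "a \<oplus> b \<preceq> (a \<oplus> b) \<otimes> (a \<oplus> b)" by (rule le_square)
  moreover have "(a \<oplus> b) \<otimes> (a \<oplus> b) \<preceq> \<langle>a, b\<rangle>" by (simp add: pair_def)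
  ultimately show ?thesis using le_trans by blast
qed

text \<open>Since i is at most m, m^2 + i is less than (m + 1)^2 and hence less than n^2. So the
  code of a pair with sum s lies between s^2 and (s + 1)^2, the latter excluded, and determines
  s.\<close>

lemma square_gap:
  assumes "m \<prec> n" "i \<preceq> m" shows "m \<otimes> m \<oplus> i \<noteq> n \<otimes> n \<oplus> j"
proof
  assume *: "m \<otimes> m \<oplus> i = n \<otimes> n \<oplus> j"
  obtain d where d: "n = m \<oplus> (d \<oplus> \<one>)" using assms by (auto simp: lt_iff add_suc)
  obtain b where b: "m = i \<oplus> b" using assms by (auto simp: le_iff)
  let ?d = "d \<oplus> \<one>"
  have "n \<otimes> n = (m \<oplus> ?d) \<otimes> m \<oplus> (m \<oplus> ?d) \<otimes> ?d"
    unfolding d distrib_left ..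
  also have "\<dots> = m \<otimes> m \<oplus> ?d \<otimes> m \<oplus> (m \<oplus> ?d) \<otimes> ?d"
    by (simp only: distrib_right)
  also have "?d \<otimes> m = d \<otimes> m \<oplus> m" by (rule mul_suc_left)
  also have "(m \<oplus> ?d) \<otimes> ?d = (m \<oplus> ?d) \<otimes> d \<oplus> (m \<oplus> ?d)" by (rule mul_suc)
  finally have "n \<otimes> n \<oplus> j = m \<otimes> m \<oplus> (m \<oplus> (d \<otimes> m \<oplus> (m \<oplus> ?d) \<otimes> d \<oplus> m \<oplus> d \<oplus> j \<oplus> \<one>))"
    by (simp add: add_ac)
  also have "m \<oplus> (d \<otimes> m \<oplus> (m \<oplus> ?d) \<otimes> d \<oplus> m \<oplus> d \<oplus> j \<oplus> \<one>) =
    i \<oplus> (b \<oplus> (d \<otimes> m \<oplus> (m \<oplus> ?d) \<otimes> d \<oplus> m \<oplus> d \<oplus> j) \<oplus> \<one>)"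
    by (subst (1) b) (simp only: add_assoc)
  finally have "m \<otimes> m \<oplus> (i \<oplus> \<zero>) = m \<otimes> m \<oplus> (i \<oplus> (b \<oplus> (d \<otimes> m \<oplus> (m \<oplus> ?d) \<otimes> d \<oplus> m \<oplus> d \<oplus> j) \<oplus> \<one>))"
    unfolding add_0 * .
  then have "i \<oplus> \<zero> = i \<oplus> (b \<oplus> (d \<otimes> m \<oplus> (m \<oplus> ?d) \<otimes> d \<oplus> m \<oplus> d \<oplus> j) \<oplus> \<one>)"
    unfolding add_left_cancel .
  then show False unfolding add_left_cancel using suc_neq_0 by metis
qed

lemma pair_inj [simp]: "\<langle>a, b\<rangle> = \<langle>c, d\<rangle> \<longleftrightarrow> a = c \<and> b = d"
proof
  assume *: "\<langle>a, b\<rangle> = \<langle>c, d\<rangle>"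
  have "\<not> a \<oplus> b \<prec> c \<oplus> d" "\<not> c \<oplus> d \<prec> a \<oplus> b"
    using square_gap[of "a \<oplus> b" "c \<oplus> d" a c] square_gap[of "c \<oplus> d" "a \<oplus> b" c a] *
    by (auto simp: pair_def)
  then have "a \<oplus> b = c \<oplus> d" using lt_linear by blast
  with * show "a = c \<and> b = d" by (auto simp: pair_def)
qed auto

section \<open>Standard numerals\<close>

lemma numer_lt: "m < n \<Longrightarrow> numer M m \<prec> numer M n"
  by (induction n) (auto simp: less_Suc_eq lt_suc)

lemma numer_inj [simp]: "numer M m = numer M n \<longleftrightarrow> m = n"
  by (metis linorder_neqE_nat lt_irrefl numer_lt)

lemma numer_lt_iff [simp]: "numer M m \<prec> numer M n \<longleftrightarrow> m < n"
  by (metis linorder_neqE_nat lt_irrefl lt_trans numer_lt)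

text \<open>Only standard numbers lie below a standard numeral. Hence \<open>below M k\<close> has
  exactly k elements even in a nonstandard model, and the pigeonhole principle for k colors can be
  used from outside.\<close>

lemma lt_numer_iff: "a \<prec> numer M n \<longleftrightarrow> (\<exists>m<n. a = numer M m)"
  by (induction n) (auto simp: less_Suc_eq lt_suc)

lemma numer_1 [simp]: "numer M (Suc 0) = \<one>" "numer M 1 = \<one>"
  by simp_all

lemma below_eq: "below M k = numer M ` {..<k}"
  by (auto simp: below_def lt_numer_iff)

text \<open>If there were no least element, induction on n would show that no element of A lies
  below n.\<close>

lemma least_element:
  assumes "A \<in> Sets M" "a \<in> A"
  shows "\<exists>b\<in>A. \<forall>c. c \<prec> b \<longrightarrow> c \<notin> A"
proof (rule ccontr)
  assume no: "\<not> ?thesis"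
  let ?p = "AllN 1 (Imp (Less (Var 1) (Var 0)) (Neg (Mem (Var 1) 0)))"
  have "{n. sat M ((\<lambda>_. a)(0 := n)) (\<lambda>_. A) ?p} \<in> Sets M"
    by (rule Sigma00_comprehension) (use assms in \<open>auto intro!: Sigma00.intros\<close>)
  then have "n \<in> {n. sat M ((\<lambda>_. a)(0 := n)) (\<lambda>_. A) ?p}" for n
    by (rule set_induct) (use no in \<open>auto simp: lt_suc\<close>)
  from this[of "a \<oplus> \<one>"] show False using assms by simp
qed

text \<open>The value of T dominates all variables that p depends on, so the search for a preimage
  is bounded by the value itself, which is held by variable N.\<close>

lemma Sigma00_image:
  assumes p: "Sigma00 p" and E: "\<And>n. E n \<in> Sets M"
    and T: "tm_vars T \<subseteq> {..<N}" "\<And>v i. i < N \<Longrightarrow> v i \<preceq> tm_val M v T"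
    and dep: "\<And>v v'. \<forall>i<N. v i = v' i \<Longrightarrow> sat M v E p = sat M v' E p"
  shows "{tm_val M v T | v. sat M v E p} \<in> Sets M"
proof -
  let ?q = "bexs N N (And (Eq (Var N) T) p)"
  define e where "e = (\<lambda>_::nat. \<zero>)"
  have "Sigma00 ?q" using p by (intro Sigma00_bexs Sigma00.intros) auto
  then have "{z. sat M (e(N := z)) E ?q} \<in> Sets M"
    using E by (rule Sigma00_comprehension)
  moreover have "sat M (e(N := z)) E ?q \<longleftrightarrow> (\<exists>v. z = tm_val M v T \<and> sat M v E p)" for z
  proof
    assume "\<exists>v. z = tm_val M v T \<and> sat M v E p"
    then obtain v where v: "z = tm_val M v T" "sat M v E p" by blast
    define w where "w = (\<lambda>i. if i < N then v i else (e(N := z)) i)"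
    have "tm_val M w T = z"
      unfolding v(1) by (rule tm_val_agree_below[OF T(1)]) (simp add: w_def)
    moreover have "sat M w E p" using v dep[of w v] by (simp add: w_def)
    ultimately show "sat M (e(N := z)) E ?q"
      unfolding sat_bexs[OF order_refl] using T(2)[of _ w]
      by (intro exI[of _ w]) (auto simp: w_def)
  qed (auto simp: sat_bexs)
  ultimately show ?thesis by simp
qed

end

section \<open>Coloring principles\<close>

lemma conflict_free_imp_proper: "conflict_free M H \<chi> \<Longrightarrow> proper M H \<chi>"
  unfolding conflict_free_def proper_def by metis

context rca0 begin

section \<open>Closure properties of the sets of the model\<close>

lemma Compl_Sets: "A \<in> Sets M \<Longrightarrow> - A \<in> Sets M"
  using Sigma00_comprehension[of "Neg (Mem (Var 0) 0)" "\<lambda>_. A" "\<lambda>_. \<zero>" 0]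
  by (simp add: Sigma00.intros Collect_neg_eq)

lemma Un_Sets:
  assumes "A \<in> Sets M" "B \<in> Sets M" shows "A \<union> B \<in> Sets M"
proof -
  have "{n. sat M ((\<lambda>_. \<zero>)(0 := n)) ((\<lambda>_. A)(1 := B)) (Or (Mem (Var 0) 0) (Mem (Var 0) 1))} \<in> Sets M"
    by (rule Sigma00_comprehension) (use assms in \<open>auto intro: Sigma00.intros\<close>)
  then show ?thesis by (simp add: Un_def)
qed

lemma Int_Sets: "A \<in> Sets M \<Longrightarrow> B \<in> Sets M \<Longrightarrow> A \<inter> B \<in> Sets M"
  using Compl_Sets[OF Un_Sets[OF Compl_Sets Compl_Sets, of A B]] by simp

lemma UNIV_Sets: "UNIV \<in> Sets M"
proof -
  obtain A where "A \<in> Sets M" using some_set by blast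
  then show ?thesis using Un_Sets[OF _ Compl_Sets, of A A] by simp
qed

lemma empty_Sets: "{} \<in> Sets M"
  using Compl_Sets[OF UNIV_Sets] by simp

lemma singleton_Sets: "{a} \<in> Sets M"
  using Sigma00_comprehension[of "Eq (Var 0) (Var 1)" "\<lambda>_. UNIV" "\<lambda>_. a" 0]
  by (simp add: Sigma00.intros UNIV_Sets)

lemma finite_UN_Sets:
  assumes "finite I" "\<And>i. i \<in> I \<Longrightarrow> A i \<in> Sets M"
  shows "(\<Union>i\<in>I. A i) \<in> Sets M"
  using assms by (induction I) (auto simp: empty_Sets Un_Sets)

lemma column_Sets: "A \<in> Sets M \<Longrightarrow> column M A i \<in> Sets M"
  using Sigma00_comprehension[of "Mem (tpair (Var 0) (Var 1)) 0" "\<lambda>_. A" "\<lambda>_. i" 0]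
  by (simp add: Sigma00.intros column_def)

lemma pair_image_Sets:
  assumes "A \<in> Sets M" shows "{\<langle>x, c\<rangle> | x. x \<in> A} \<in> Sets M"
proof -
  have "{z. sat M ((\<lambda>_. c)(0 := z)) (\<lambda>_. A)
     (ExN 1 (And (Less (Var 1) (Plus (Var 0) On)) (And (Eq (Var 0) (tpair (Var 1) (Var 2))) (Mem (Var 1) 0))))} \<in> Sets M"
    by (rule Sigma00_comprehension) (use assms in \<open>auto intro!: Sigma00.intros\<close>)
  also have "{z. sat M ((\<lambda>_. c)(0 := z)) (\<lambda>_. A)
     (ExN 1 (And (Less (Var 1) (Plus (Var 0) On)) (And (Eq (Var 0) (tpair (Var 1) (Var 2))) (Mem (Var 1) 0))))}
     = {\<langle>x, c\<rangle> | x. x \<in> A}"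
    by auto
  finally show ?thesis .
qed

section \<open>Functions of the model\<close>

lemma is_funD:
  assumes "is_fun M f X Y" "x \<in> X"
  shows "\<langle>x, y\<rangle> \<in> f \<longleftrightarrow> app M f x = y" "app M f x \<in> Y"
proof -
  obtain z where z: "\<langle>x, z\<rangle> \<in> f" "\<And>y. \<langle>x, y\<rangle> \<in> f \<Longrightarrow> y = z"
    using assms unfolding is_fun_def by blast
  then have "app M f x = z" unfolding app_def by (intro the_equality)
  moreover have "\<exists>a\<in>X. \<exists>b\<in>Y. \<langle>x, z\<rangle> = \<langle>a, b\<rangle>"
    using assms(1) z(1) unfolding is_fun_def by blast
  then have "z \<in> Y" by auto
  ultimately show "\<langle>x, y\<rangle> \<in> f \<longleftrightarrow> app M f x = y" "app M f x \<in> Y" using z by metis+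
qed

text \<open>Since k is standard, the graph is a union of finitely many products of a fiber with a
  single color.\<close>

lemma function_of_fibers:
  assumes "\<And>x. g x < k" "\<And>s. s < k \<Longrightarrow> {x. g x = s} \<in> Sets M"
  shows "\<exists>f. is_fun M f UNIV (below M k) \<and> (\<forall>x. app M f x = numer M (g x))"
proof -
  define f where "f = (\<Union>s\<in>{..<k}. {\<langle>x, numer M s\<rangle> | x. x \<in> {x. g x = s}})"
  have "f \<in> Sets M" unfolding f_def
    by (intro finite_UN_Sets pair_image_Sets assms(2)) auto
  moreover have f: "\<langle>x, y\<rangle> \<in> f \<longleftrightarrow> y = numer M (g x)" for x y
    using assms(1) by (auto simp: f_def)
  ultimately have "is_fun M f UNIV (below M k)"
    unfolding is_fun_def below_eq using assms(1) by (auto simp: f_def)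
  moreover have "app M f x = numer M (g x)" for x
    using f by (simp add: app_def)
  ultimately show ?thesis by blast
qed

lemma constant_coloring:
  assumes "k \<ge> 1"
  shows "\<exists>f. is_fun M f UNIV (below M k)"
proof -
  have "{x. (0::nat) = s} \<in> Sets M" for s
    using UNIV_Sets empty_Sets by (cases s) simp_all
  then show ?thesis using function_of_fibers[of "\<lambda>_. 0" k] assms by auto
qed

lemma indicator_function:
  assumes "A \<in> Sets M"
  shows "\<exists>f. is_fun M f UNIV (below M 2) \<and> (\<forall>i. app M f i = \<one> \<longleftrightarrow> i \<in> A)"
proof -
  have "\<exists>f. is_fun M f UNIV (below M 2) \<and> (\<forall>x. app M f x = numer M (if x \<in> A then 1 else 0))"
  proof (rule function_of_fibers, goal_cases)
    case (2 s)
    have "{x. (if x \<in> A then 1 else 0) = s} = (if s = 1 then A else if s = 0 then - A else {})"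
      by auto
    then show ?case using assms by (simp add: Compl_Sets empty_Sets)
  qed simp
  moreover have "numer M (if i \<in> A then 1 else 0) = \<one> \<longleftrightarrow> i \<in> A" for i
    using numer_inj[of 0 1] by (simp del: numer_inj)
  ultimately show ?thesis by metis
qed

definition colorable_proper where
  "colorable_proper k H \<longleftrightarrow> (\<exists>\<chi>. is_coloring M k H \<chi> \<and> proper M H \<chi>)"

definition colorable_cf where
  "colorable_cf k H \<longleftrightarrow> (\<exists>\<chi>. is_coloring M k H \<chi> \<and> conflict_free M H \<chi>)"

text \<open>The common core of both principles. Conflict-free colorability implies proper
  colorability, so the two conditions make both of them equivalent to Q at every index, and either
  principle then yields the set of indices with Q.\<close>

definition decides :: "nat \<Rightarrow> bool" where
  "decides k \<longleftrightarrow> (\<forall>H Q. is_hypergraph_seq M H \<longrightarrow>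
     (\<forall>i. colorable_proper k (hyp_at M H i) \<longrightarrow> Q i) \<longrightarrow>
     (\<forall>i. Q i \<longrightarrow> colorable_cf k (hyp_at M H i)) \<longrightarrow> {i. Q i} \<in> Sets M)"

lemma fun_eq_one_Sets:
  assumes "is_fun M f UNIV (below M 2)" shows "{i. app M f i = \<one>} \<in> Sets M"
proof -
  have "f \<in> Sets M" using assms by (simp add: is_fun_def)
  then have "{i. \<langle>i, \<one>\<rangle> \<in> f} \<in> Sets M" using column_Sets[of f \<one>] by (simp add: column_def)
  then show ?thesis using is_funD(1)[OF assms] by simp
qed

lemma colorable_cf_imp_proper: "colorable_cf k H \<Longrightarrow> colorable_proper k H"
  unfolding colorable_cf_def colorable_proper_def using conflict_free_imp_proper by blast

lemma decidesI:
  assumes "proper_coloring_principle M k \<or> conflict_free_coloring_principle M k"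
  shows "decides k"
  unfolding decides_def
proof (intro allI impI)
  fix H Q
  assume H: "is_hypergraph_seq M H"
    and p: "\<forall>i. colorable_proper k (hyp_at M H i) \<longrightarrow> Q i"
    and c: "\<forall>i. Q i \<longrightarrow> colorable_cf k (hyp_at M H i)"
  from assms obtain f where f: "is_fun M f UNIV (below M 2)"
    and "(\<forall>i. app M f i = \<one> \<longleftrightarrow> colorable_proper k (hyp_at M H i)) \<or>
      (\<forall>i. app M f i = \<one> \<longleftrightarrow> colorable_cf k (hyp_at M H i))"
    unfolding proper_coloring_principle_def conflict_free_coloring_principle_def
      colorable_proper_def colorable_cf_def using H by meson
  then have "\<forall>i. app M f i = \<one> \<longleftrightarrow> Q i"
    using p c colorable_cf_imp_proper by blast
  then show "{i. Q i} \<in> Sets M" using fun_eq_one_Sets[OF f] by simp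
qed

text \<open>With every number as a vertex, the requirement that edges consist of vertices is
  trivial. Numbers without a role in a construction are vertices as well and merely need some
  color.\<close>

lemma column_hypergraph_seq:
  assumes "I \<in> Sets M" "C \<in> Sets M"
  shows "is_hypergraph_seq M \<lparr>Vert = UNIV, Idx = I, Inc = C\<rparr>"
  using assms unfolding is_hypergraph_seq_def is_hypergraph_def hyp_at_def
  by (auto simp: column_Sets UNIV_Sets) (simp add: column_def)

lemma Vert_hyp_at_UNIV: "Vert (hyp_at M \<lparr>Vert = UNIV, Idx = I, Inc = C\<rparr> i) = UNIV"
  by (simp add: hyp_at_def column_def)

lemma edges_hyp_at:
  "edges M (hyp_at M H i) = {{w. \<langle>\<langle>w, j\<rangle>, i\<rangle> \<in> Inc H} | j. \<langle>j, i\<rangle> \<in> Idx H}"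
  by (auto simp: edges_def hyp_at_def column_def)

lemma no_injective_coloring:
  assumes "\<And>s. s \<le> k \<Longrightarrow> c s \<in> below M k"
  shows "\<exists>s t. s < t \<and> t \<le> k \<and> c s = c t"
proof (rule ccontr)
  assume "\<not> ?thesis"
  then have "inj_on c {..k}" by (metis atMost_iff inj_onI linorder_neqE_nat)
  moreover have "c ` {..k} \<subseteq> numer M ` {..<k}" using assms by (auto simp: below_eq)
  ultimately have "card {..k} \<le> card (numer M ` {..<k})" by (intro card_inj_on_le) auto
  also have "\<dots> \<le> k" using card_image_le[of "{..<k}" "numer M"] by simp
  finally show False by simp
qed

text \<open>Each witness \<open>x\<close> contributes a complete graph on the vertices \<open>0, \<dots>, k\<close>.\<close>

lemma decides_projection:
  assumes "decides k" "k \<ge> 1" "A \<in> Sets M"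
  shows "{n. \<exists>x. \<langle>x, n\<rangle> \<in> A} \<in> Sets M"
proof -
  \<comment> \<open>Only \<open>RCA0\<close> is available here, so the codes must be images under
    bounded formulas. Variables 0 to 4 stand for the witness x, the ends s and t of an edge, the
    position n in the sequence, and the vertex w.\<close>
  let ?pI = "And (Mem (tpair (Var 0) (Var 3)) 0) (And (Less (Var 1) (Var 2)) (Less (Var 2) (tnum (Suc k))))"
  let ?TI = "tpair (tpair (Var 0) (tpair (Var 1) (Var 2))) (Var 3)"
  let ?pC = "Or (Eq (Var 4) (Var 1)) (Eq (Var 4) (Var 2))"
  let ?TC = "tpair (tpair (Var 4) (tpair (Var 0) (tpair (Var 1) (Var 2)))) (Var 3)"
  define I where "I = {tm_val M v ?TI | v. sat M v (\<lambda>_. A) ?pI}"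
  define C where "C = {tm_val M v ?TC | v. sat M v (\<lambda>_. A) ?pC}"
  have trans: "a \<preceq> \<langle>b, c\<rangle>" if "a \<preceq> b \<or> a \<preceq> c" for a b c
    using that le_trans[OF _ le_pair_left] le_trans[OF _ le_pair_right] by blast
  have "I \<in> Sets M" unfolding I_def
    by (rule Sigma00_image[where N=4])
      (use assms in \<open>auto intro!: Sigma00.intros trans simp: numeral_eq_Suc less_Suc_eq\<close>)
  moreover have "C \<in> Sets M" unfolding C_def
    by (rule Sigma00_image[where N=5])
      (use assms in \<open>auto intro!: Sigma00.intros trans simp: numeral_eq_Suc less_Suc_eq\<close>)
  moreover define H where "H = \<lparr>Vert = UNIV, Idx = I, Inc = C\<rparr>"
  ultimately have H: "is_hypergraph_seq M H" by (simp add: column_hypergraph_seq)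
  have I: "\<langle>\<langle>x, \<langle>s, t\<rangle>\<rangle>, n\<rangle> \<in> I \<longleftrightarrow> \<langle>x, n\<rangle> \<in> A \<and> s \<prec> t \<and> t \<prec> numer M (Suc k)" for x s t n
    unfolding I_def by (auto intro!: exI[of _ "\<lambda>i. if i = 0 then x else if i = 1 then s else if i = 2 then t else n"])
  have C: "\<langle>\<langle>w, \<langle>x, \<langle>s, t\<rangle>\<rangle>\<rangle>, n\<rangle> \<in> C \<longleftrightarrow> w = s \<or> w = t" for w x s t n
    unfolding C_def by (auto intro!: exI[of _ "\<lambda>i. if i = 0 then x else if i = 1 then s else if i = 2 then t else if i = 3 then n else w"])
  have "\<not> (\<exists>x. \<langle>x, n\<rangle> \<in> A)" if "colorable_proper k (hyp_at M H n)" for n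
  proof
    assume "\<exists>x. \<langle>x, n\<rangle> \<in> A"
    then obtain x where x: "\<langle>x, n\<rangle> \<in> A" ..
    from that obtain \<chi> where \<chi>: "is_fun M \<chi> UNIV (below M k)" and pr: "proper M (hyp_at M H n) \<chi>"
      by (auto simp: colorable_proper_def is_coloring_def H_def Vert_hyp_at_UNIV)
    obtain s t where st: "s < t" "t \<le> k" "app M \<chi> (numer M s) = app M \<chi> (numer M t)"
      using no_injective_coloring[of k "\<lambda>s. app M \<chi> (numer M s)"] is_funD(2)[OF \<chi>] by blast
    have "{numer M s, numer M t} \<in> edges M (hyp_at M H n)"
      unfolding edges_hyp_at H_def
      using x st(1,2) by (auto intro!: exI[of _ "\<langle>x, \<langle>numer M s, numer M t\<rangle>\<rangle>"] simp: I C simp del: numer.simps)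
    then have "app M \<chi> (numer M s) \<noteq> app M \<chi> (numer M t)"
      using pr st(1) unfolding proper_def by fastforce
    with st show False by simp
  qed
  moreover have "colorable_cf k (hyp_at M H n)" if "\<not> (\<exists>x. \<langle>x, n\<rangle> \<in> A)" for n
  proof -
    \<comment> \<open>Without a witness there are no edges at all, so any coloring is
      conflict-free.\<close>
    have "j \<notin> I" if "j = \<langle>m, n\<rangle>" for j m
      unfolding I_def using that \<open>\<not> (\<exists>x. \<langle>x, n\<rangle> \<in> A)\<close> by auto
    then have "edges M (hyp_at M H n) = {}"
      by (auto simp: edges_hyp_at H_def)
    moreover obtain f where "is_fun M f UNIV (below M k)"
      using constant_coloring[OF assms(2)] by blast
    ultimately show ?thesis
      unfolding colorable_cf_def is_coloring_def conflict_free_def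
      by (auto simp: H_def Vert_hyp_at_UNIV)
  qed
  ultimately have "{n. \<not> (\<exists>x. \<langle>x, n\<rangle> \<in> A)} \<in> Sets M"
    using assms(1)[unfolded decides_def, rule_format, OF H] by simp
  then show ?thesis using Compl_Sets by (force simp: Compl_eq)
qed

end

section \<open>Arithmetical comprehension\<close>

text \<open>Only the first n values are coded, and n is standard, so iterated pairing suffices and
  no coding of finite sequences inside the model is involved.\<close>

primrec code :: "'m l2_structure \<Rightarrow> (nat \<Rightarrow> 'm) \<Rightarrow> nat \<Rightarrow> 'm" where
  "code M e 0 = Zero M"
| "code M e (Suc n) = pair M (e n) (code M e n)"

primrec tcode :: "(nat \<Rightarrow> tm) \<Rightarrow> nat \<Rightarrow> tm" where
  "tcode \<sigma> 0 = Zer"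
| "tcode \<sigma> (Suc n) = tpair (\<sigma> n) (tcode \<sigma> n)"

lemma tm_val_tcode [simp]: "tm_val M e (tcode \<sigma> n) = code M (\<lambda>i. tm_val M e (\<sigma> i)) n"
  by (induction n) auto

lemma tm_vars_tcode: "tm_vars (tcode \<sigma> n) = (\<Union>i<n. tm_vars (\<sigma> i))"
  by (induction n) (auto simp: lessThan_Suc)

lemma code_cong: "(\<And>i. i < n \<Longrightarrow> e i = e' i) \<Longrightarrow> code M e n = code M e' n"
  by (induction n) auto

context rca0 begin

lemma code_inj: "code M e n = code M e' n \<longleftrightarrow> (\<forall>i<n. e i = e' i)"
  by (induction n) (auto simp: less_Suc_eq)

lemma le_code: "i < n \<Longrightarrow> e i \<preceq> code M e n"
proof (induction n)
  case (Suc n)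
  then show ?case using le_trans[of "e i" "code M e n"] by (auto simp: less_Suc_eq)
qed simp

end

text \<open>Closure under projection amounts to \<open>Sigma01\<close> comprehension with set
  parameters, which gives arithmetical comprehension by iteration. It is exactly what
  \<open>decides_projection\<close> supplies.\<close>

locale aca0 = rca0 +
  assumes projection: "A \<in> Sets M \<Longrightarrow> {n. \<exists>x. \<langle>x, n\<rangle> \<in> A} \<in> Sets M"
begin

lemma Sigma00_code:
  assumes "Sigma00 p" "\<And>n. E n \<in> Sets M"
  shows "\<exists>m. \<forall>n\<ge>m. \<exists>A\<in>Sets M. \<forall>e. sat M e E p \<longleftrightarrow> code M e n \<in> A"
proof -
  obtain m where m: "\<And>e e' E. \<forall>i<m. e i = e' i \<Longrightarrow> sat M e E p = sat M e' E p"
    using sat_agree_below[of M p] by blast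
  have "\<exists>A\<in>Sets M. \<forall>e. sat M e E p \<longleftrightarrow> code M e n \<in> A" if "n \<ge> m" for n
  proof -
    have dep: "sat M v E p = sat M v' E p" if "\<forall>i<n. v i = v' i" for v v'
      by (rule m) (use that \<open>n \<ge> m\<close> in auto)
    have "{tm_val M v (tcode Var n) | v. sat M v E p} \<in> Sets M"
      by (rule Sigma00_image[OF assms, of _ n]) (auto simp: tm_vars_tcode dep le_code)
    moreover have "code M e n \<in> {tm_val M v (tcode Var n) | v. sat M v E p} \<longleftrightarrow> sat M e E p" for e
      using dep[of e] by (auto simp: code_inj)
    ultimately show ?thesis by blast
  qed
  then show ?thesis by blast
qed

lemma ex_code:
  assumes "A \<in> Sets M"
  shows "\<exists>B\<in>Sets M. \<forall>e. (\<exists>a. code M (e(x := a)) n \<in> A) \<longleftrightarrow> code M e n \<in> B"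
proof -
  \<comment> \<open>Component n of a tuple of length n + 1 holds the witness for x. It is outermost
    in the code, just where \<open>projection\<close> removes it, and \<open>?\<sigma>\<close> moves
    it back to the place of x.\<close>
  let ?\<sigma> = "\<lambda>i. if i = x then Var n else Var i"
  let ?B = "{tm_val M v (tcode Var (Suc n)) | v. sat M v (\<lambda>_. A) (Mem (tcode ?\<sigma> n) 0)}"
  have val: "(\<lambda>i. tm_val M v (?\<sigma> i)) = v(x := v n)" for v by auto
  have "?B \<in> Sets M"
    by (rule Sigma00_image[of _ _ _ "Suc n"])
      (use assms le_code[of _ "Suc n"] in \<open>auto intro!: Sigma00.intros arg_cong[of _ _ "\<lambda>x. x \<in> A"] code_cong simp: val tm_vars_tcode\<close>)
  then have "{c. \<exists>a. \<langle>a, c\<rangle> \<in> ?B} \<in> Sets M" by (rule projection)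
  moreover have "\<langle>a, code M e n\<rangle> \<in> ?B \<longleftrightarrow> code M (e(x := a)) n \<in> A" for a e
  proof
    assume "\<langle>a, code M e n\<rangle> \<in> ?B"
    then obtain v where "a = v n" "\<forall>i<n. e i = v i" "code M (v(x := v n)) n \<in> A"
      by (auto simp: val code_inj)
    moreover from this have "code M (v(x := v n)) n = code M (e(x := a)) n"
      by (auto intro!: code_cong)
    ultimately show "code M (e(x := a)) n \<in> A" by simp
  next
    assume *: "code M (e(x := a)) n \<in> A"
    have "code M (e(n := a)) n = code M e n" "code M ((e(n := a))(x := a)) n = code M (e(x := a)) n"
      by (auto intro!: code_cong)
    then show "\<langle>a, code M e n\<rangle> \<in> ?B" using * by (auto intro!: exI[of _ "e(n := a)"] simp: val)
  qed
  ultimately show ?thesis by (intro bexI) auto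
qed

text \<open>Connectives become Boolean operations on sets of codes, and quantifiers become
  projections by \<open>ex_code\<close>. The claim covers all large n so that two subformulas can be
  coded with a common length.\<close>

lemma arithmetical_code:
  assumes "arithmetical p" "\<And>n. E n \<in> Sets M"
  shows "\<exists>m. \<forall>n\<ge>m. \<exists>A\<in>Sets M. \<forall>e. sat M e E p \<longleftrightarrow> code M e n \<in> A"
  using assms(1)
proof (induction p)
  case (Eq s t)
  then show ?case using assms(2) by (intro Sigma00_code) (auto intro: Sigma00.intros)
next
  case (Less s t)
  then show ?case using assms(2) by (intro Sigma00_code) (auto intro: Sigma00.intros)
next
  case (Mem t X)
  then show ?case using assms(2) by (intro Sigma00_code) (auto intro: Sigma00.intros)
next
  case (Neg p)
  then obtain m where m: "\<And>n. n \<ge> m \<Longrightarrow> \<exists>A\<in>Sets M. \<forall>e. sat M e E p \<longleftrightarrow> code M e n \<in> A" by auto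
  have "\<exists>A\<in>Sets M. \<forall>e. sat M e E (Neg p) \<longleftrightarrow> code M e n \<in> A" if n: "n \<ge> m" for n
  proof -
    obtain A where "A \<in> Sets M" "\<forall>e. sat M e E p \<longleftrightarrow> code M e n \<in> A" using m[OF n] by blast
    then show ?thesis by (intro bexI[of _ "- A"]) (auto intro: Compl_Sets)
  qed
  then show ?case by blast
next
  case (ExN x p)
  then obtain m where m: "\<And>n. n \<ge> m \<Longrightarrow> \<exists>A\<in>Sets M. \<forall>e. sat M e E p \<longleftrightarrow> code M e n \<in> A" by auto
  have "\<exists>A\<in>Sets M. \<forall>e. sat M e E (ExN x p) \<longleftrightarrow> code M e n \<in> A" if n: "n \<ge> m" for n
  proof -
    obtain A where A: "A \<in> Sets M" "\<forall>e. sat M e E p \<longleftrightarrow> code M e n \<in> A" using m[OF n] by blast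
    then show ?thesis using ex_code[OF A(1)] by simp
  qed
  then show ?case by blast
next
  case (AllN x p)
  then obtain m where m: "\<And>n. n \<ge> m \<Longrightarrow> \<exists>A\<in>Sets M. \<forall>e. sat M e E p \<longleftrightarrow> code M e n \<in> A" by auto
  have "\<exists>A\<in>Sets M. \<forall>e. sat M e E (AllN x p) \<longleftrightarrow> code M e n \<in> A" if n: "n \<ge> m" for n
  proof -
    obtain A where A: "A \<in> Sets M" "\<forall>e. sat M e E p \<longleftrightarrow> code M e n \<in> A" using m[OF n] by blast
    obtain B where "B \<in> Sets M" "\<forall>e. (\<exists>a. code M (e(x := a)) n \<in> - A) \<longleftrightarrow> code M e n \<in> B"
      using ex_code[OF Compl_Sets[OF A(1)], of x n] by (elim bexE)
    then show ?thesis using A by (intro bexI[of _ "- B"]) (auto intro: Compl_Sets)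
  qed
  then show ?case by blast
next
  case (And p q)
  then obtain m m' where m: "\<And>n. n \<ge> m \<Longrightarrow> \<exists>A\<in>Sets M. \<forall>e. sat M e E p \<longleftrightarrow> code M e n \<in> A"
    "\<And>n. n \<ge> m' \<Longrightarrow> \<exists>A\<in>Sets M. \<forall>e. sat M e E q \<longleftrightarrow> code M e n \<in> A" by auto
  have "\<exists>A\<in>Sets M. \<forall>e. sat M e E (And p q) \<longleftrightarrow> code M e n \<in> A" if n: "n \<ge> max m m'" for n
  proof -
    obtain A B where "A \<in> Sets M" "B \<in> Sets M" "\<forall>e. sat M e E p \<longleftrightarrow> code M e n \<in> A"
      "\<forall>e. sat M e E q \<longleftrightarrow> code M e n \<in> B" using m[of n] n by auto
    then show ?thesis by (intro bexI[of _ "A \<inter> B"]) (auto intro: Int_Sets)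
  qed
  then show ?case by blast
next
  case (Or p q)
  then obtain m m' where m: "\<And>n. n \<ge> m \<Longrightarrow> \<exists>A\<in>Sets M. \<forall>e. sat M e E p \<longleftrightarrow> code M e n \<in> A"
    "\<And>n. n \<ge> m' \<Longrightarrow> \<exists>A\<in>Sets M. \<forall>e. sat M e E q \<longleftrightarrow> code M e n \<in> A" by auto
  have "\<exists>A\<in>Sets M. \<forall>e. sat M e E (Or p q) \<longleftrightarrow> code M e n \<in> A" if n: "n \<ge> max m m'" for n
  proof -
    obtain A B where "A \<in> Sets M" "B \<in> Sets M" "\<forall>e. sat M e E p \<longleftrightarrow> code M e n \<in> A"
      "\<forall>e. sat M e E q \<longleftrightarrow> code M e n \<in> B" using m[of n] n by auto
    then show ?thesis by (intro bexI[of _ "A \<union> B"]) (auto intro: Un_Sets)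
  qed
  then show ?case by blast
next
  case (Imp p q)
  then obtain m m' where m: "\<And>n. n \<ge> m \<Longrightarrow> \<exists>A\<in>Sets M. \<forall>e. sat M e E p \<longleftrightarrow> code M e n \<in> A"
    "\<And>n. n \<ge> m' \<Longrightarrow> \<exists>A\<in>Sets M. \<forall>e. sat M e E q \<longleftrightarrow> code M e n \<in> A" by auto
  have "\<exists>A\<in>Sets M. \<forall>e. sat M e E (Imp p q) \<longleftrightarrow> code M e n \<in> A" if n: "n \<ge> max m m'" for n
  proof -
    obtain A B where "A \<in> Sets M" "B \<in> Sets M" "\<forall>e. sat M e E p \<longleftrightarrow> code M e n \<in> A"
      "\<forall>e. sat M e E q \<longleftrightarrow> code M e n \<in> B" using m[of n] n by auto
    then show ?thesis by (intro bexI[of _ "- A \<union> B"]) (auto intro: Un_Sets Compl_Sets)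
  qed
  then show ?case by blast
next
  case (Iff p q)
  then obtain m m' where m: "\<And>n. n \<ge> m \<Longrightarrow> \<exists>A\<in>Sets M. \<forall>e. sat M e E p \<longleftrightarrow> code M e n \<in> A"
    "\<And>n. n \<ge> m' \<Longrightarrow> \<exists>A\<in>Sets M. \<forall>e. sat M e E q \<longleftrightarrow> code M e n \<in> A" by auto
  have "\<exists>A\<in>Sets M. \<forall>e. sat M e E (Iff p q) \<longleftrightarrow> code M e n \<in> A" if n: "n \<ge> max m m'" for n
  proof -
    obtain A B where "A \<in> Sets M" "B \<in> Sets M" "\<forall>e. sat M e E p \<longleftrightarrow> code M e n \<in> A"
      "\<forall>e. sat M e E q \<longleftrightarrow> code M e n \<in> B" using m[of n] n by auto
    then show ?thesis by (intro bexI[of _ "(- A \<union> B) \<inter> (- B \<union> A)"]) (auto intro: Un_Sets Compl_Sets Int_Sets)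
  qed
  then show ?case by blast
qed simp_all

lemma arithmetical_comprehension:
  assumes "arithmetical p" "\<And>n. E n \<in> Sets M"
  shows "{n. sat M (e(x := n)) E p} \<in> Sets M"
proof -
  obtain n A where A: "A \<in> Sets M" "\<forall>e. sat M e E p \<longleftrightarrow> code M e n \<in> A"
    using arithmetical_code[OF assms] by (meson order_refl)
  have "{a. sat M (e(x := a)) (\<lambda>_. A) (Mem (tcode Var n) 0)} \<in> Sets M"
    by (rule Sigma00_comprehension) (use A in \<open>auto intro: Sigma00.intros\<close>)
  then show ?thesis using A(2) by (simp add: fun_upd_def)
qed

lemma arithmetical_image:
  assumes "arithmetical p" "\<And>n. E n \<in> Sets M"
  shows "{tm_val M v T | v. sat M v E p} \<in> Sets M"
proof -
  obtain n where n: "\<forall>v v' E. (\<forall>i<n. v i = v' i) \<longrightarrow>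
      tm_val M v T = tm_val M v' T \<and> sat M v E p = sat M v' E p"
    using agree_below_max[OF tm_val_agree_ex[of M T] sat_agree_below[of M p]] by blast
  let ?q = "exs n (And (Eq (Var n) T) p)"
  have "{z. sat M ((\<lambda>_. \<zero>)(n := z)) E ?q} \<in> Sets M"
    using assms by (intro arithmetical_comprehension arithmetical_exs) auto
  moreover have "sat M ((\<lambda>_. \<zero>)(n := z)) E ?q \<longleftrightarrow> (\<exists>v. z = tm_val M v T \<and> sat M v E p)" for z
  proof
    assume "\<exists>v. z = tm_val M v T \<and> sat M v E p"
    then obtain v where v: "z = tm_val M v T" "sat M v E p" by blast
    define w where "w = (\<lambda>i. if i < n then v i else ((\<lambda>_. \<zero>)(n := z)) i)"
    have "\<forall>i<n. w i = v i" by (simp add: w_def)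
    then have "tm_val M w T = z" "sat M w E p" using v n by metis+
    then show "sat M ((\<lambda>_. \<zero>)(n := z)) E ?q"
      unfolding sat_exs by (intro exI[of _ w]) (auto simp: w_def)
  qed (auto simp: sat_exs)
  ultimately show ?thesis by simp
qed

end

section \<open>NOR networks and kernels\<close>

text \<open>\<open>NX t\<close> stands for \<open>t \<notin> X\<close>, where \<open>X\<close> is the quantified set variable, and \<open>NEx x a\<close> for \<open>\<not> (\<exists>x. a)\<close>:
  every compound gate is true iff all its inputs are false.\<close>

datatype gate = At form | NX tm | Nor gate gate | NEx nat gate

text \<open>Countability provides \<open>to_nat\<close>, the standard number by which a gate enters
  the codes of its nodes.\<close>

instance tm :: countable by countable_datatype
instance form :: countable by countable_datatype
instance gate :: countable by countable_datatype

primrec gate_form :: "nat \<Rightarrow> gate \<Rightarrow> form" where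
  "gate_form X (At f) = f"
| "gate_form X (NX t) = Neg (Mem t X)"
| "gate_form X (Nor a b) = And (Neg (gate_form X a)) (Neg (gate_form X b))"
| "gate_form X (NEx x a) = AllN x (Neg (gate_form X a))"

primrec subgates :: "gate \<Rightarrow> gate set" where
  "subgates (At f) = {At f}"
| "subgates (NX t) = {NX t}"
| "subgates (Nor a b) = insert (Nor a b) (subgates a \<union> subgates b)"
| "subgates (NEx x a) = insert (NEx x a) (subgates a)"

text \<open>Independence of X and of the variables from n on is stated semantically for formula
  leaves. It is what allows an instance of a gate to be identified by n values of an
  assignment.\<close>

primrec good_gate :: "'m l2_structure \<Rightarrow> nat \<Rightarrow> nat \<Rightarrow> gate \<Rightarrow> bool" where
  "good_gate M X n (At f) \<longleftrightarrow> arithmetical f \<and>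
     (\<forall>e E A. sat M e (E(X := A)) f = sat M e E f) \<and>
     (\<forall>e e' E. (\<forall>i<n. e i = e' i) \<longrightarrow> sat M e E f = sat M e' E f)"
| "good_gate M X n (NX t) \<longleftrightarrow> tm_vars t \<subseteq> {..<n}"
| "good_gate M X n (Nor a b) \<longleftrightarrow> good_gate M X n a \<and> good_gate M X n b"
| "good_gate M X n (NEx x a) \<longleftrightarrow> good_gate M X n a"

abbreviation gneg :: "gate \<Rightarrow> gate" where "gneg a \<equiv> Nor a a"

text \<open>Set quantifiers get a dummy leaf: the translation is meant for arithmetical formulas,
  and with this value it is good for all formulas. Membership in X needs a double negation because
  the available leaf expresses its negation.\<close>

primrec form_gate :: "nat \<Rightarrow> form \<Rightarrow> gate" where
  "form_gate X (Eq s t) = At (Eq s t)"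
| "form_gate X (Less s t) = At (Less s t)"
| "form_gate X (Mem t Z) = (if Z = X then gneg (NX t) else At (Mem t Z))"
| "form_gate X (Neg p) = gneg (form_gate X p)"
| "form_gate X (And p q) = Nor (gneg (form_gate X p)) (gneg (form_gate X q))"
| "form_gate X (Or p q) = gneg (Nor (form_gate X p) (form_gate X q))"
| "form_gate X (Imp p q) = gneg (Nor (gneg (form_gate X p)) (form_gate X q))"
| "form_gate X (Iff p q) = Nor (Nor (gneg (form_gate X p)) (form_gate X q))
                               (Nor (form_gate X p) (gneg (form_gate X q)))"
| "form_gate X (AllN x p) = NEx x (gneg (form_gate X p))"
| "form_gate X (ExN x p) = gneg (NEx x (form_gate X p))"
| "form_gate X (AllS Z p) = At (Eq Zer Zer)"
| "form_gate X (ExS Z p) = At (Eq Zer Zer)"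

section \<open>Correctness of the translation into gates\<close>

lemma sat_gate_form_form_gate:
  "arithmetical p \<Longrightarrow> sat M e E (gate_form X (form_gate X p)) = sat M e E p"
  by (induction p arbitrary: e) auto

lemma good_gate_mono: "good_gate M X m g \<Longrightarrow> m \<le> n \<Longrightarrow> good_gate M X n g"
  by (induction g) (auto simp: subset_iff)

lemma good_gate_both:
  assumes "\<exists>n. good_gate M X n a" "\<exists>n. good_gate M X n b"
  shows "\<exists>n. good_gate M X n a \<and> good_gate M X n b"
  using assms good_gate_mono max.cobounded1 max.cobounded2 by metis

lemma good_gate_At:
  assumes "arithmetical f" "\<And>e E A. sat M e (E(X := A)) f = sat M e E f"
  shows "\<exists>n. good_gate M X n (At f)"
  using sat_agree_below[of M f] assms by simp

lemma good_gate_form_gate: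
  fixes M :: "'m l2_structure"
  shows "\<exists>n. good_gate M X n (form_gate X p)"
proof (induction p)
  case (Mem t Z)
  show ?case
  proof (cases "Z = X")
    case True
    then show ?thesis using tm_vars_bounded[of t] by simp
  next
    case False
    then show ?thesis unfolding form_gate.simps if_not_P[OF False] by (intro good_gate_At) auto
  qed
next
  case (And p q)
  show ?case using good_gate_both[OF And.IH] by simp
next
  case (Or p q)
  show ?case using good_gate_both[OF Or.IH] by simp
next
  case (Imp p q)
  show ?case using good_gate_both[OF Imp.IH] by simp
next
  case (Iff p q)
  show ?case using good_gate_both[OF Iff.IH] by simp
next
  case (Eq s t)
  show ?case unfolding form_gate.simps by (rule good_gate_At) auto
next
  case (Less s t)
  show ?case unfolding form_gate.simps by (rule good_gate_At) auto
qed auto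

lemma finite_subgates: "finite (subgates g)"
  by (induction g) auto

lemma self_subgate: "g \<in> subgates g"
  by (cases g) auto

lemma subgates_trans: "a \<in> subgates b \<Longrightarrow> b \<in> subgates g \<Longrightarrow> a \<in> subgates g"
  by (induction g) auto

lemma good_subgate: "q \<in> subgates g \<Longrightarrow> good_gate M X n g \<Longrightarrow> good_gate M X n q"
  by (induction g) auto

lemma arithmetical_gate_form: "good_gate M X n g \<Longrightarrow> arithmetical (gate_form X g)"
  by (induction g) auto

lemma sat_gate_form_agree:
  "good_gate M X n g \<Longrightarrow> (\<And>i. i < n \<Longrightarrow> e i = e' i) \<Longrightarrow>
    sat M e E (gate_form X g) = sat M e' E (gate_form X g)"
proof (induction g arbitrary: e e')
  case (At f)
  then show ?case by simp
next
  case (NX t)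
  then show ?case using tm_val_agree_below[of t n e e' M] by simp
next
  case (Nor a b)
  show ?case using Nor.IH(1)[of e e'] Nor.IH(2)[of e e'] Nor.prems by simp
next
  case (NEx x a)
  have "sat M (e(x := c)) E (gate_form X a) = sat M (e'(x := c)) E (gate_form X a)" for c
    by (rule NEx.IH) (use NEx.prems in auto)
  then show ?case by simp
qed

context rca0 begin

text \<open>A pair \<langle>v, u\<rangle> in R is a wire from v to u. With arcs read from u to its
  inputs, this is the usual notion: Y is independent, and every node outside Y has an input in
  Y.\<close>

definition kernel :: "'m set \<Rightarrow> 'm set \<Rightarrow> bool" where
  "kernel R Y \<longleftrightarrow> (\<forall>u. u \<in> Y \<longleftrightarrow> (\<forall>v. \<langle>v, u\<rangle> \<in> R \<longrightarrow> v \<notin> Y))"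

end

locale gate_graph = aca0 +
  fixes E :: "nat \<Rightarrow> 'a set" and X n :: nat and g :: gate
  assumes E: "E i \<in> Sets M" and good: "good_gate M X n g"
begin

text \<open>The nodes \<open>vnode a\<close> and \<open>wnode a\<close> form a 2-cycle, so a kernel contains exactly one of them, and the
  choice is free: this is how a kernel codes \<open>X\<close>. The node \<open>top\<close> has no inputs and is always true.\<close>

definition vnode where "vnode a = \<langle>numer M 0, a\<rangle>"
definition wnode where "wnode a = \<langle>numer M 1, a\<rangle>"
definition top where "top = \<langle>numer M 2, \<zero>\<rangle>"
text \<open>The tags 0, 1 and 2 belong to the other kinds of nodes, hence the shift by 3.\<close>

definition node where "node q e = \<langle>numer M (to_nat q + 3), code M e n\<rangle>"

definition tnode where "tnode q \<sigma> = tpair (tnum (to_nat q + 3)) (tcode \<sigma> n)"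

lemma tm_val_tnode [simp]: "tm_val M e (tnode q \<sigma>) = node q (\<lambda>i. tm_val M e (\<sigma> i))"
  by (simp add: tnode_def node_def del: numer.simps numer_1)

lemma node_eq_iff: "node q e = node q' e' \<longleftrightarrow> q = q' \<and> (\<forall>i<n. e i = e' i)"
  by (simp add: node_def code_inj del: numer.simps numer_1)

lemma node_distinct [simp]:
  "vnode a \<noteq> node q e" "wnode a \<noteq> node q e" "top \<noteq> node q e" "vnode a \<noteq> wnode b"
  "vnode a \<noteq> top" "wnode a \<noteq> top" "node q e \<noteq> vnode a" "node q e \<noteq> wnode a" "node q e \<noteq> top"
  "wnode b \<noteq> vnode a" "top \<noteq> vnode a" "top \<noteq> wnode a"
  by (simp_all add: node_def vnode_def wnode_def top_def del: numer.simps numer_1)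

lemma vnode_inj [simp]: "vnode a = vnode b \<longleftrightarrow> a = b" "wnode a = wnode b \<longleftrightarrow> a = b"
  by (simp_all add: vnode_def wnode_def)

text \<open>A leaf with a false formula is fed by \<open>top\<close>, which makes it false; one with
  a true formula has no input and so is true. The variable of type \<open>unit\<close> only
  expresses a set that is a singleton or empty.\<close>

primrec children :: "gate \<Rightarrow> (nat \<Rightarrow> 'a) \<Rightarrow> 'a set" where
  "children (At f) e = {top | z::unit. \<not> sat M e E f}"
| "children (NX t) e = {vnode (tm_val M e t)}"
| "children (Nor a b) e = {node a e, node b e}"
| "children (NEx x a) e = range (\<lambda>c. node a (e(x := c)))"

definition arcs where "arcs q = {\<langle>v, node q e\<rangle> | v e. v \<in> children q e}"

definition graph where
  "graph = {\<langle>wnode a, vnode a\<rangle> | a. True} \<union> {\<langle>vnode a, wnode a\<rangle> | a. True} \<union> (\<Union>q\<in>subgates g. arcs q)"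

section \<open>The digraph is a set of the model\<close>

lemma ex_value_0: "(\<exists>v::nat \<Rightarrow> 'a. P (v 0)) \<longleftrightarrow> (\<exists>a. P a)"
  by (auto intro: exI[of _ "\<lambda>_. _"])

lemma image_Sets_cong:
  assumes "arithmetical p" "\<And>i. F i \<in> Sets M" "{tm_val M v T | v. sat M v F p} = B"
  shows "B \<in> Sets M"
  using arithmetical_image[OF assms(1), of F T] assms(2,3) by blast

lemma arcs_Sets: "q \<in> subgates g \<Longrightarrow> arcs q \<in> Sets M"
proof (cases q)
  case (At f)
  assume "q \<in> subgates g"
  then have "arithmetical f" using good_subgate[OF _ good, of q] At by auto
  then have "arithmetical (Neg f)" by simp
  then show ?thesis
    by (rule image_Sets_cong[of _ E "tpair (tpair (tnum 2) Zer) (tnode q Var)"])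
      (rule E, auto simp: arcs_def At top_def simp del: numer.simps numer_1)
next
  case (NX t)
  show ?thesis
    by (rule image_Sets_cong[of "Eq Zer Zer" E "tpair (tpair (tnum 0) t) (tnode q Var)"])
      (auto simp: arcs_def NX vnode_def E)
next
  case (Nor a b)
  have *: "{\<langle>node c e, node q e\<rangle> | e. True} \<in> Sets M" for c
    by (rule image_Sets_cong[of "Eq Zer Zer" E "tpair (tnode c Var) (tnode q Var)"])
      (auto simp: E simp del: numer.simps numer_1)
  have eq: "arcs q = {\<langle>node a e, node q e\<rangle> | e. True} \<union> {\<langle>node b e, node q e\<rangle> | e. True}"
    by (auto simp: arcs_def Nor)
  show ?thesis unfolding eq by (rule Un_Sets[OF * *])
next
  case (NEx x a)
  \<comment> \<open>The value given to x at the input node is kept in variable n, which the code of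
    \<open>node q\<close> does not see.\<close>
  let ?\<sigma> = "\<lambda>i. if i = x then Var n else Var i"
  have val: "(\<lambda>i. tm_val M v (?\<sigma> i)) = v(x := v n)" for v by auto
  have "{tm_val M v (tpair (tnode a ?\<sigma>) (tnode q Var)) | v. sat M v E (Eq Zer Zer)} = arcs q"
  proof -
    have "\<exists>v. \<langle>node a (e(x := c)), node q e\<rangle> = \<langle>node a (v(x := v n)), node q v\<rangle>" for e c
      by (rule exI[of _ "e(n := c)"]) (auto simp: node_eq_iff)
    then show ?thesis by (auto simp: arcs_def NEx val)
  qed
  then show ?thesis by (rule image_Sets_cong[rotated 2]) (simp_all add: E)
qed

lemma graph_Sets: "graph \<in> Sets M"
proof -
  have "{\<langle>wnode a, vnode a\<rangle> | a. True} \<in> Sets M"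
    by (rule image_Sets_cong[of "Eq Zer Zer" E "tpair (tpair (tnum 1) (Var 0)) (tpair (tnum 0) (Var 0))"])
      (simp_all add: E vnode_def wnode_def ex_value_0[of "\<lambda>a. _ = \<langle>\<langle>_, a\<rangle>, \<langle>_, a\<rangle>\<rangle>"])
  moreover have "{\<langle>vnode a, wnode a\<rangle> | a. True} \<in> Sets M"
    by (rule image_Sets_cong[of "Eq Zer Zer" E "tpair (tpair (tnum 0) (Var 0)) (tpair (tnum 1) (Var 0))"])
      (simp_all add: E vnode_def wnode_def ex_value_0[of "\<lambda>a. _ = \<langle>\<langle>_, a\<rangle>, \<langle>_, a\<rangle>\<rangle>"])
  ultimately show ?thesis unfolding graph_def
    by (intro Un_Sets finite_UN_Sets finite_subgates arcs_Sets)
qed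

lemma children_cong:
  assumes "q \<in> subgates g" "\<forall>i<n. e i = e' i"
  shows "children q e = children q e'"
proof -
  have good_q: "good_gate M X n q" using good_subgate[OF assms(1) good] .
  show ?thesis
  proof (cases q)
    case (At f)
    then have "sat M e E f = sat M e' E f" using good_q assms(2) by auto
    then show ?thesis using At by simp
  next
    case (NX t)
    then show ?thesis using good_q assms(2) tm_val_agree_below[of t n e e'] by simp
  next
    case (Nor a b)
    then show ?thesis using assms(2) by (simp add: node_def code_cong[of n e e'])
  next
    case (NEx x a)
    have "node a (e(x := c)) = node a (e'(x := c))" for c using assms(2) by (simp add: node_eq_iff)
    then show ?thesis using NEx by simp
  qed
qed

lemma graph_node: "q \<in> subgates g \<Longrightarrow> \<langle>v, node q e\<rangle> \<in> graph \<longleftrightarrow> v \<in> children q e"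
  using children_cong[of q e] by (auto simp: graph_def arcs_def node_eq_iff)

lemma graph_vnode: "\<langle>v, vnode a\<rangle> \<in> graph \<longleftrightarrow> v = wnode a"
  and graph_wnode: "\<langle>v, wnode a\<rangle> \<in> graph \<longleftrightarrow> v = vnode a"
  and graph_top: "\<langle>v, top\<rangle> \<notin> graph"
  by (auto simp: graph_def arcs_def)

text \<open>The kernel equation at a node is the truth condition of its gate. The induction runs
  over the syntax of the gate, outside the model, so its correctness is unaffected by nonstandard
  numbers.\<close>

lemma kernel_node:
  assumes Y: "kernel graph Y" and q: "q \<in> subgates g"
  shows "node q e \<in> Y \<longleftrightarrow> sat M e (E(X := {a. vnode a \<in> Y})) (gate_form X q)"
  using q
proof (induction q arbitrary: e)
  case (At f)
  have "top \<in> Y" using Y graph_top unfolding kernel_def by blast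
  then have "node (At f) e \<in> Y \<longleftrightarrow> sat M e E f"
    using Y[unfolded kernel_def, rule_format, of "node (At f) e"] graph_node[OF At] by auto
  moreover have "sat M e (E(X := A)) f = sat M e E f" for A
    using good_subgate[OF At good] by (simp only: good_gate.simps)
  ultimately show ?case by (simp only: gate_form.simps)
next
  case (NX t)
  then have "node (NX t) e \<in> Y \<longleftrightarrow> vnode (tm_val M e t) \<notin> Y"
    using Y[unfolded kernel_def, rule_format, of "node (NX t) e"] graph_node[OF NX] by simp
  then show ?case by simp
next
  case (Nor a b)
  then have "a \<in> subgates g" "b \<in> subgates g"
    using subgates_trans[of a "Nor a b" g] subgates_trans[of b "Nor a b" g] self_subgate by auto
  moreover from this have "node (Nor a b) e \<in> Y \<longleftrightarrow> node a e \<notin> Y \<and> node b e \<notin> Y"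
    using Y[unfolded kernel_def, rule_format, of "node (Nor a b) e"] graph_node[OF Nor.prems] by auto
  ultimately show ?case using Nor.IH by simp
next
  case (NEx x a)
  then have "a \<in> subgates g"
    using subgates_trans[of a "NEx x a" g] self_subgate by auto
  then have "node (NEx x a) e \<in> Y \<longleftrightarrow> (\<forall>c. node a (e(x := c)) \<notin> Y)"
    using Y[unfolded kernel_def, rule_format, of "node (NEx x a) e"] graph_node[OF NEx.prems] by auto
  then show ?case unfolding NEx.IH[OF \<open>a \<in> subgates g\<close>] gate_form.simps sat.simps .
qed

lemma kernel_exists:
  assumes A: "A \<in> Sets M"
  shows "\<exists>Y\<in>Sets M. kernel graph Y \<and> {a. vnode a \<in> Y} = A"
proof -
  let ?F = "E(X := A)"
  have F: "?F i \<in> Sets M" for i using A E by simp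
  \<comment> \<open>\<open>B\<close> collects the false nodes, and the kernel is its complement. The
    complement also contains all numbers that are not nodes; these have no inputs and so must belong
    to any kernel.\<close>
  define B where "B = {vnode a | a. a \<notin> A} \<union> {wnode a | a. a \<in> A} \<union>
    (\<Union>q\<in>subgates g. {node q e | e. \<not> sat M e ?F (gate_form X q)})"
  have "{vnode a | a. a \<notin> A} \<in> Sets M"
    by (rule image_Sets_cong[of "Neg (Mem (Var 0) 0)" "\<lambda>_. A" "tpair (tnum 0) (Var 0)"])
      (simp_all add: A vnode_def ex_value_0[of "\<lambda>a. _ = \<langle>_, a\<rangle> \<and> a \<notin> A"])
  moreover have "{wnode a | a. a \<in> A} \<in> Sets M"
    by (rule image_Sets_cong[of "Mem (Var 0) 0" "\<lambda>_. A" "tpair (tnum 1) (Var 0)"])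
      (simp_all add: A wnode_def ex_value_0[of "\<lambda>a. _ = \<langle>_, a\<rangle> \<and> a \<in> A"])
  moreover have "{node q e | e. \<not> sat M e ?F (gate_form X q)} \<in> Sets M" if "q \<in> subgates g" for q
    by (rule image_Sets_cong[of "Neg (gate_form X q)" ?F "tnode q Var"])
      (use F arithmetical_gate_form[OF good_subgate[OF that good]] in auto)
  ultimately have "B \<in> Sets M" unfolding B_def
    by (intro Un_Sets finite_UN_Sets finite_subgates)
  define Y where "Y = - B"
  have v: "vnode a \<in> Y \<longleftrightarrow> a \<in> A" and w: "wnode a \<in> Y \<longleftrightarrow> a \<notin> A" and t: "top \<in> Y" for a
    by (auto simp: Y_def B_def)
  have nd: "node q e \<in> Y \<longleftrightarrow> sat M e ?F (gate_form X q)" if "q \<in> subgates g" for q e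
  proof -
    have "sat M e ?F (gate_form X q) = sat M e' ?F (gate_form X q)" if "\<forall>i<n. e i = e' i" for e'
      by (rule sat_gate_form_agree[OF good_subgate[OF \<open>q \<in> subgates g\<close> good]]) (use that in simp)
    moreover have "node q e \<in> Y \<longleftrightarrow> \<not> (\<exists>e'. (\<forall>i<n. e i = e' i) \<and> \<not> sat M e' ?F (gate_form X q))"
      using that by (auto simp: Y_def B_def node_eq_iff)
    ultimately show ?thesis by blast
  qed
  have "u \<in> Y \<longleftrightarrow> (\<forall>v. \<langle>v, u\<rangle> \<in> graph \<longrightarrow> v \<notin> Y)" for u
  proof -
    consider (v) a where "u = vnode a" | (w) a where "u = wnode a"
      | (n) q e where "q \<in> subgates g" "u = node q e"
      | (o) "\<forall>a. u \<noteq> vnode a" "\<forall>a. u \<noteq> wnode a" "\<forall>q\<in>subgates g. \<forall>e. u \<noteq> node q e" by blast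
    then show ?thesis
    proof cases
      case v
      then show ?thesis by (simp add: graph_vnode \<open>\<And>a. vnode a \<in> Y \<longleftrightarrow> a \<in> A\<close> \<open>\<And>a. wnode a \<in> Y \<longleftrightarrow> a \<notin> A\<close>)
    next
      case w
      then show ?thesis by (simp add: graph_wnode \<open>\<And>a. vnode a \<in> Y \<longleftrightarrow> a \<in> A\<close> \<open>\<And>a. wnode a \<in> Y \<longleftrightarrow> a \<notin> A\<close>)
    next
      case o
      then have "u \<in> Y" "\<langle>v, u\<rangle> \<notin> graph" for v
        by (auto simp: Y_def B_def graph_def arcs_def)
      then show ?thesis by blast
    next
      case n
      have "node q e \<in> Y \<longleftrightarrow> (\<forall>v\<in>children q e. v \<notin> Y)"
      proof (cases q)
        case (At f)
        then show ?thesis using nd[OF n(1)] t good_subgate[OF n(1) good] by auto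
      next
        case (NX t)
        then show ?thesis using nd[OF n(1)] v by auto
      next
        case (Nor a b)
        then have "a \<in> subgates g" "b \<in> subgates g"
          using n(1) subgates_trans[of a "Nor a b" g] subgates_trans[of b "Nor a b" g] self_subgate by auto
        then show ?thesis using nd n(1) Nor by auto
      next
        case (NEx x a)
        then have "a \<in> subgates g"
          using n(1) subgates_trans[of a "NEx x a" g] self_subgate by auto
        then show ?thesis using nd n(1) NEx by auto
      qed
      then show ?thesis using n graph_node[OF n(1)] by auto
    qed
  qed
  then have "kernel graph Y" unfolding kernel_def by blast
  moreover have "{a. vnode a \<in> Y} = A" using v by auto
  ultimately show ?thesis using Compl_Sets[OF \<open>B \<in> Sets M\<close>] by (auto simp: Y_def)
qed

lemma Sigma11_kernel:
  "(\<exists>A\<in>Sets M. sat M e (E(X := A)) (gate_form X g)) \<longleftrightarrow>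
   (\<exists>Y\<in>Sets M. kernel graph Y \<and> node g e \<in> Y)"
proof
  assume "\<exists>A\<in>Sets M. sat M e (E(X := A)) (gate_form X g)"
  then obtain A where A: "A \<in> Sets M" "sat M e (E(X := A)) (gate_form X g)" by blast
  then obtain Y where Y: "Y \<in> Sets M" "kernel graph Y" "{a. vnode a \<in> Y} = A"
    using kernel_exists by blast
  then show "\<exists>Y\<in>Sets M. kernel graph Y \<and> node g e \<in> Y"
    using A kernel_node[OF Y(2) self_subgate] by blast
next
  assume "\<exists>Y\<in>Sets M. kernel graph Y \<and> node g e \<in> Y"
  then obtain Y where Y: "Y \<in> Sets M" "kernel graph Y" "node g e \<in> Y" by blast
  have "{a. \<langle>numer M 0, a\<rangle> \<in> Y} \<in> Sets M"
    using Sigma00_comprehension[of "Mem (tpair Zer (Var 0)) 0" "\<lambda>_. Y" "\<lambda>_. \<zero>" 0] Y(1)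
    by (simp add: Sigma00.intros)
  then have "{a. vnode a \<in> Y} \<in> Sets M" by (simp add: vnode_def)
  then show "\<exists>A\<in>Sets M. sat M e (E(X := A)) (gate_form X g)"
    using kernel_node[OF Y(2) self_subgate] Y(3) by blast
qed

lemma root_Sets: "{\<langle>node g (e(x := i)), i\<rangle> | i. True} \<in> Sets M"
proof -
  \<comment> \<open>The index y is fresh: it differs from x and lies beyond the n variables that the
    code of a node reads.\<close>
  obtain y where y: "y = Suc (max x n)" by simp
  have "{z. sat M (e(y := z)) E (ExN x (Eq (Var y) (tpair (tnode g Var) (Var x))))} \<in> Sets M"
    using E by (intro arithmetical_comprehension) auto
  moreover have "node g ((e(y := z))(x := i)) = node g (e(x := i))" for z i
    by (auto simp: node_eq_iff y)
  moreover have "y \<noteq> x" by (simp add: y)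
  ultimately show ?thesis by (simp add: fun_upd_def[symmetric])
qed

end

text \<open>The set for the universal formula is the complement of the set for the existential
  formula with negated matrix. One digraph serves all instances; the parameter i only moves the
  output node, whose dependence on i is a set of the model.\<close>

lemma (in aca0) Pi11_comprehensionI:
  assumes kernels: "\<And>R r. R \<in> Sets M \<Longrightarrow> {\<langle>r i, i\<rangle> | i. True} \<in> Sets M \<Longrightarrow>
    {i. \<exists>Y\<in>Sets M. kernel R Y \<and> r i \<in> Y} \<in> Sets M"
  shows "Pi11_comprehension M"
  unfolding Pi11_comprehension_def
proof (intro allI impI)
  fix p x e and E :: "nat \<Rightarrow> 'a set"
  assume "Pi11 p" and E: "range E \<subseteq> Sets M"
  then obtain X q where p: "p = AllS X q" and q: "arithmetical q" by (auto elim: Pi11.cases)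
  define g where "g = form_gate X (Neg q)"
  obtain n where n: "good_gate M X n g" using good_gate_form_gate g_def by blast
  interpret gate_graph M E X n g by unfold_locales (use E n in auto)
  have g: "sat M e E (gate_form X g) \<longleftrightarrow> \<not> sat M e E q" for e E
    unfolding g_def by (subst sat_gate_form_form_gate) (use q in auto)
  have "{i. \<exists>Y\<in>Sets M. kernel graph Y \<and> node g (e(x := i)) \<in> Y} \<in> Sets M"
    by (rule kernels[OF graph_Sets root_Sets])
  then have "{i. \<exists>A\<in>Sets M. \<not> sat M (e(x := i)) (E(X := A)) q} \<in> Sets M"
    unfolding Sigma11_kernel[symmetric] g .
  from Compl_Sets[OF this] show "\<exists>A\<in>Sets M. \<forall>i. i \<in> A \<longleftrightarrow> sat M (e(x := i)) E p"
    by (rule bexI[rotated]) (simp add: p)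
qed

section \<open>From kernels to hypergraphs\<close>

locale kernel_hypergraph = aca0 +
  fixes k :: nat and R :: "'a set" and r :: "'a \<Rightarrow> 'a"
  assumes k: "k \<ge> 2" and R: "R \<in> Sets M" and r: "{\<langle>r i, i\<rangle> | i. True} \<in> Sets M"
begin

declare numer.simps [simp del] numer_1 [simp del] tnum.simps [simp del]

abbreviation num ("\<sharp>_" [1000] 1000) where "\<sharp>s \<equiv> numer M s"

text \<open>When colored true, \<open>pos u\<close> says that u is in the kernel,
  \<open>neg u\<close> that it is not, and \<open>sel v u\<close> that v is a designated input of u
  that lies in the kernel. The vertices \<open>cst \<sharp>0\<close> to \<open>cst \<sharp>k\<close>
  serve as the palette.\<close>

definition cst where "cst s = \<langle>\<sharp>0, s\<rangle>"
definition pos where "pos u = \<langle>\<sharp>1, u\<rangle>"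
definition neg where "neg u = \<langle>\<sharp>2, u\<rangle>"
definition sel where "sel v u = \<langle>\<sharp>3, \<langle>v, u\<rangle>\<rangle>"

lemma vertex_inj [simp]:
  "cst s = cst t \<longleftrightarrow> s = t" "pos u = pos v \<longleftrightarrow> u = v" "neg u = neg v \<longleftrightarrow> u = v"
  "sel v u = sel v' u' \<longleftrightarrow> v = v' \<and> u = u'"
  "cst s \<noteq> pos u" "cst s \<noteq> neg u" "cst s \<noteq> sel v u'" "pos u \<noteq> neg u'" "pos u \<noteq> sel v u'" "neg u \<noteq> sel v u'"
  "pos u \<noteq> cst s" "neg u \<noteq> cst s" "sel v u' \<noteq> cst s" "neg u' \<noteq> pos u" "sel v u' \<noteq> pos u" "sel v u' \<noteq> neg u"
  by (auto simp: cst_def pos_def neg_def sel_def)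

text \<open>The colors of \<open>cst \<sharp>0\<close> and \<open>cst \<sharp>1\<close> stand for false and true. The vertex \<open>cst \<sharp>k\<close> is forced to
  be false as well; a second false vertex leaves a conflict-free coloring no choice but to make
  exactly one of \<open>pos u\<close> and the selectors \<open>sel v u\<close> true.\<close>

definition inc :: "'a \<Rightarrow> 'a \<Rightarrow> 'a \<Rightarrow> bool" where
  "inc w j i \<longleftrightarrow>
     (\<exists>s t. j = \<langle>\<sharp>0, \<langle>s, t\<rangle>\<rangle> \<and> s \<prec> t \<and> t \<prec> \<sharp>(Suc k) \<and> \<not> (s = \<sharp>0 \<and> t = \<sharp>k) \<and> (w = cst s \<or> w = cst t)) \<or>
     (\<exists>s c y. j = \<langle>\<sharp>1, \<langle>s, \<langle>c, y\<rangle>\<rangle>\<rangle> \<and> \<sharp>1 \<prec> s \<and> s \<prec> \<sharp>k \<and> \<sharp>0 \<prec> c \<and> c \<prec> \<sharp>4 \<and> (w = cst s \<or> w = \<langle>c, y\<rangle>)) \<or>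
     (\<exists>u. j = \<langle>\<sharp>2, u\<rangle> \<and> (w = pos u \<or> w = neg u)) \<or>
     (\<exists>u. j = \<langle>\<sharp>3, u\<rangle> \<and> (w = cst \<sharp>0 \<or> w = cst \<sharp>k \<or> w = pos u \<or> (\<exists>v. \<langle>v, u\<rangle> \<in> R \<and> w = sel v u))) \<or>
     (\<exists>v u. j = \<langle>\<sharp>4, \<langle>v, u\<rangle>\<rangle> \<and> \<langle>v, u\<rangle> \<in> R \<and> (w = cst \<sharp>1 \<or> w = pos u \<or> w = pos v)) \<or>
     (\<exists>v u. j = \<langle>\<sharp>5, \<langle>v, u\<rangle>\<rangle> \<and> \<langle>v, u\<rangle> \<in> R \<and> (w = cst \<sharp>1 \<or> w = sel v u \<or> w = neg v)) \<or>
     (\<exists>x. j = \<langle>\<sharp>6, \<sharp>0\<rangle> \<and> \<langle>x, i\<rangle> \<in> {\<langle>r i, i\<rangle> | i. True} \<and> (w = cst \<sharp>0 \<or> w = pos x))"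

text \<open>Number variables 0, 1, 2 are w, j, i; set variables 0 and 1 are R and the graph of r. In
  \<open>inc\<close> the map r occurs through its graph, since a formula can refer to it only in
  that way.\<close>

definition inc_form :: form where
  "inc_form =
     Or (ExN 3 (ExN 4 (And (Eq (Var 1) (tpair (tnum 0) (tpair (Var 3) (Var 4))))
          (And (Less (Var 3) (Var 4)) (And (Less (Var 4) (tnum (Suc k)))
          (And (Neg (And (Eq (Var 3) (tnum 0)) (Eq (Var 4) (tnum k))))
            (Or (Eq (Var 0) (tpair (tnum 0) (Var 3))) (Eq (Var 0) (tpair (tnum 0) (Var 4))))))))))
    (Or (ExN 3 (ExN 4 (ExN 5 (And (Eq (Var 1) (tpair (tnum 1) (tpair (Var 3) (tpair (Var 4) (Var 5)))))
          (And (Less (tnum 1) (Var 3)) (And (Less (Var 3) (tnum k))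
          (And (Less (tnum 0) (Var 4)) (And (Less (Var 4) (tnum 4))
            (Or (Eq (Var 0) (tpair (tnum 0) (Var 3))) (Eq (Var 0) (tpair (Var 4) (Var 5))))))))))))
    (Or (ExN 3 (And (Eq (Var 1) (tpair (tnum 2) (Var 3)))
            (Or (Eq (Var 0) (tpair (tnum 1) (Var 3))) (Eq (Var 0) (tpair (tnum 2) (Var 3))))))
    (Or (ExN 3 (And (Eq (Var 1) (tpair (tnum 3) (Var 3)))
            (Or (Eq (Var 0) (tpair (tnum 0) (tnum 0))) (Or (Eq (Var 0) (tpair (tnum 0) (tnum k)))
            (Or (Eq (Var 0) (tpair (tnum 1) (Var 3)))
                (ExN 4 (And (Mem (tpair (Var 4) (Var 3)) 0)
                            (Eq (Var 0) (tpair (tnum 3) (tpair (Var 4) (Var 3)))))))))))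
    (Or (ExN 3 (ExN 4 (And (Eq (Var 1) (tpair (tnum 4) (tpair (Var 3) (Var 4))))
          (And (Mem (tpair (Var 3) (Var 4)) 0)
            (Or (Eq (Var 0) (tpair (tnum 0) (tnum 1))) (Or (Eq (Var 0) (tpair (tnum 1) (Var 4)))
                (Eq (Var 0) (tpair (tnum 1) (Var 3)))))))))
    (Or (ExN 3 (ExN 4 (And (Eq (Var 1) (tpair (tnum 5) (tpair (Var 3) (Var 4))))
          (And (Mem (tpair (Var 3) (Var 4)) 0)
            (Or (Eq (Var 0) (tpair (tnum 0) (tnum 1))) (Or (Eq (Var 0) (tpair (tnum 3) (tpair (Var 3) (Var 4))))
                (Eq (Var 0) (tpair (tnum 2) (Var 3)))))))))
        (ExN 3 (And (Eq (Var 1) (tpair (tnum 6) (tnum 0)))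
          (And (Mem (tpair (Var 3) (Var 2)) 1)
            (Or (Eq (Var 0) (tpair (tnum 0) (tnum 0))) (Eq (Var 0) (tpair (tnum 1) (Var 3))))))))))))"

lemma sat_inc_form:
  "sat M v ((\<lambda>_. R)(1 := {\<langle>r i, i\<rangle> | i. True})) inc_form \<longleftrightarrow> inc (v 0) (v 1) (v 2)"
  unfolding inc_form_def inc_def cst_def pos_def neg_def sel_def by simp

lemma arithmetical_inc_form: "arithmetical inc_form"
  by (simp add: inc_form_def)

definition hyp :: "'a hypergraph" where
  "hyp = \<lparr>Vert = UNIV, Idx = {\<langle>j, i\<rangle> | w j i. inc w j i}, Inc = {\<langle>\<langle>w, j\<rangle>, i\<rangle> | w j i. inc w j i}\<rparr>"

lemma hyp_seq: "is_hypergraph_seq M hyp"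
proof -
  have ex: "(\<exists>v::nat \<Rightarrow> 'a. P (v 0) (v 1) (v 2)) \<longleftrightarrow> (\<exists>w j i. P w j i)" for P
  proof
    assume "\<exists>w j i. P w j i"
    then obtain w j i where "P w j i" by blast
    then show "\<exists>v::nat \<Rightarrow> 'a. P (v 0) (v 1) (v 2)"
      by (intro exI[of _ "\<lambda>n. if n = 0 then w else if n = 1 then j else i"]) simp
  qed blast
  have E: "((\<lambda>_. R)(1 := {\<langle>r i, i\<rangle> | i. True})) n \<in> Sets M" for n using R r by simp
  have "{tm_val M v (tpair (Var 1) (Var 2)) | v. sat M v ((\<lambda>_. R)(1 := {\<langle>r i, i\<rangle> | i. True})) inc_form} \<in> Sets M"
    by (rule arithmetical_image[OF arithmetical_inc_form E])
  then have "{\<langle>j, i\<rangle> | w j i. inc w j i} \<in> Sets M"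
    unfolding sat_inc_form using ex[of "\<lambda>w j i. _ = \<langle>j, i\<rangle> \<and> inc w j i"] by simp
  moreover have "{tm_val M v (tpair (tpair (Var 0) (Var 1)) (Var 2)) | v. sat M v ((\<lambda>_. R)(1 := {\<langle>r i, i\<rangle> | i. True})) inc_form} \<in> Sets M"
    by (rule arithmetical_image[OF arithmetical_inc_form E])
  then have "{\<langle>\<langle>w, j\<rangle>, i\<rangle> | w j i. inc w j i} \<in> Sets M"
    unfolding sat_inc_form using ex[of "\<lambda>w j i. _ = \<langle>\<langle>w, j\<rangle>, i\<rangle> \<and> inc w j i"] by simp
  ultimately show ?thesis unfolding hyp_def by (rule column_hypergraph_seq)
qed

lemma edges_hyp: "edges M (hyp_at M hyp i) = {{w. inc w j i} | j. \<exists>w. inc w j i}"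
  by (auto simp: edges_hyp_at hyp_def)

lemma is_coloring_hyp: "is_coloring M k (hyp_at M hyp i) \<chi> \<longleftrightarrow> is_fun M \<chi> UNIV (below M k)"
  by (simp add: is_coloring_def hyp_def Vert_hyp_at_UNIV)

lemma proper_edge:
  assumes "proper M (hyp_at M hyp i) \<chi>" "inc u j i" "inc v j i" "u \<noteq> v"
    and "\<And>w. inc w j i \<Longrightarrow> app M \<chi> w = c"
  shows False
proof -
  have "{w. inc w j i} \<in> edges M (hyp_at M hyp i)" using assms(2) by (auto simp: edges_hyp)
  then show False using assms unfolding proper_def by fastforce
qed

text \<open>Once vertices carry truth values, an edge through a constant is a clause: its other
  vertices cannot all share the value of that constant. Tag 2 makes \<open>neg u\<close> opposite to
  \<open>pos u\<close>. Tag 3 says that u or one of its selectors is true, tag 4 that the ends of an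
  arc are not both true, tag 5 that a selected input is true, and tag 6 that \<open>r i\<close> is
  true.\<close>

lemma proper_imp_kernel:
  assumes \<chi>: "is_fun M \<chi> UNIV (below M k)" and pr: "proper M (hyp_at M hyp i) \<chi>"
  shows "\<exists>Y\<in>Sets M. kernel R Y \<and> r i \<in> Y"
proof -
  define c where "c w = app M \<chi> w" for w
  have c_below: "c w \<in> below M k" for w using is_funD(2)[OF \<chi>] by (simp add: c_def)
  note mono = proper_edge[OF pr, folded c_def]
  have cst: "c (cst \<sharp>s) \<noteq> c (cst \<sharp>t)" if "s < t" "t \<le> k" "s \<noteq> 0 \<or> t \<noteq> k" for s t
  proof
    assume "c (cst \<sharp>s) = c (cst \<sharp>t)"
    then show False
      using mono[of "cst \<sharp>s" "\<langle>\<sharp>0, \<langle>\<sharp>s, \<sharp>t\<rangle>\<rangle>" "cst \<sharp>t" "c (cst \<sharp>s)"] that by (auto simp: inc_def)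
  qed
  \<comment> \<open>Among k + 1 vertices two share a color, and the pair 0, k is the only one not
    joined by an edge.\<close>
  have cst_k: "c (cst \<sharp>k) = c (cst \<sharp>0)"
  proof -
    obtain s t where "s < t" "t \<le> k" "c (cst \<sharp>s) = c (cst \<sharp>t)"
      using no_injective_coloring[of k "\<lambda>s. c (cst \<sharp>s)"] c_below by blast
    then show ?thesis using cst[of s t] by (cases "s = 0 \<and> t = k") auto
  qed
  have TF: "c (cst \<sharp>0) \<noteq> c (cst \<sharp>1)" using cst[of 0 1] k by auto
  have bool: "c \<langle>\<sharp>a, y\<rangle> = c (cst \<sharp>0) \<or> c \<langle>\<sharp>a, y\<rangle> = c (cst \<sharp>1)" if a: "0 < a" "a < 4" for a y
  proof -
    have ne: "c \<langle>\<sharp>a, y\<rangle> \<noteq> c (cst \<sharp>s)" if "1 < s" "s < k" for s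
    proof
      assume "c \<langle>\<sharp>a, y\<rangle> = c (cst \<sharp>s)"
      moreover have "\<langle>\<sharp>a, y\<rangle> \<noteq> cst \<sharp>s" using a by (simp add: cst_def)
      ultimately show False
        using mono[of "cst \<sharp>s" "\<langle>\<sharp>1, \<langle>\<sharp>s, \<langle>\<sharp>a, y\<rangle>\<rangle>\<rangle>" "\<langle>\<sharp>a, y\<rangle>" "c (cst \<sharp>s)"] that a by (auto simp: inc_def)
    qed
    \<comment> \<open>The vertex takes the place of \<open>cst \<sharp>k\<close> among k + 1
      vertices. The first k constants have distinct colors, so it repeats one of these, and the
      edges with tag 1 leave only the first two.\<close>
    obtain s t where st: "s < t" "t \<le> k"
      "(if s = k then c \<langle>\<sharp>a, y\<rangle> else c (cst \<sharp>s)) = (if t = k then c \<langle>\<sharp>a, y\<rangle> else c (cst \<sharp>t))"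
      using no_injective_coloring[of k "\<lambda>s. if s = k then c \<langle>\<sharp>a, y\<rangle> else c (cst \<sharp>s)"] c_below
      by (metis (no_types, lifting))
    then have "t = k" using cst[of s t] by (auto split: if_splits)
    then have "c \<langle>\<sharp>a, y\<rangle> = c (cst \<sharp>s)" using st by auto
    moreover from this ne have "s = 0 \<or> s = 1" using st \<open>t = k\<close> by (metis One_nat_def less_one linorder_neqE_nat)
    ultimately show ?thesis by auto
  qed
  have bools: "c (pos u) = c (cst \<sharp>0) \<or> c (pos u) = c (cst \<sharp>1)"
    "c (neg u) = c (cst \<sharp>0) \<or> c (neg u) = c (cst \<sharp>1)"
    "c (sel v u) = c (cst \<sharp>0) \<or> c (sel v u) = c (cst \<sharp>1)" for u v
    unfolding pos_def neg_def sel_def by (rule bool; simp)+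
  have neg: "c (neg u) \<noteq> c (pos u)" for u
  proof
    assume "c (neg u) = c (pos u)"
    then show False using mono[of "pos u" "\<langle>\<sharp>2, u\<rangle>" "neg u" "c (pos u)"] by (auto simp: inc_def)
  qed
  define Y where "Y = {u. c (pos u) = c (cst \<sharp>1)}"
  have F: "c (pos u) = c (cst \<sharp>0)" if "u \<notin> Y" for u
    using that bools(1) by (auto simp: Y_def)
  have "v \<notin> Y" if "u \<in> Y" "\<langle>v, u\<rangle> \<in> R" for u v
  proof
    assume "v \<in> Y"
    then show False
      using mono[of "cst \<sharp>1" "\<langle>\<sharp>4, \<langle>v, u\<rangle>\<rangle>" "pos u" "c (cst \<sharp>1)"] that by (auto simp: inc_def Y_def)
  qed
  moreover have "\<exists>v. \<langle>v, u\<rangle> \<in> R \<and> v \<in> Y" if u: "u \<notin> Y" for u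
  proof -
    have "\<exists>v. \<langle>v, u\<rangle> \<in> R \<and> c (sel v u) \<noteq> c (cst \<sharp>0)"
    proof (rule ccontr)
      assume "\<nexists>v. \<langle>v, u\<rangle> \<in> R \<and> c (sel v u) \<noteq> c (cst \<sharp>0)"
      then show False
        using mono[of "cst \<sharp>0" "\<langle>\<sharp>3, u\<rangle>" "pos u" "c (cst \<sharp>0)"] F[OF u] cst_k by (auto simp: inc_def)
    qed
    then obtain v where v: "\<langle>v, u\<rangle> \<in> R" "c (sel v u) = c (cst \<sharp>1)" using bools(3) by blast
    then have "c (neg v) \<noteq> c (cst \<sharp>1)"
      using mono[of "cst \<sharp>1" "\<langle>\<sharp>5, \<langle>v, u\<rangle>\<rangle>" "neg v" "c (cst \<sharp>1)"] by (auto simp: inc_def)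
    then have "v \<in> Y" using neg[of v] bools(1)[of v] bools(2)[of v] by (auto simp: Y_def)
    then show ?thesis using v by blast
  qed
  ultimately have "kernel R Y" unfolding kernel_def by blast
  moreover have "r i \<in> Y"
  proof (rule ccontr)
    assume "r i \<notin> Y"
    then show False
      using mono[of "cst \<sharp>0" "\<langle>\<sharp>6, \<sharp>0\<rangle>" "pos (r i)" "c (cst \<sharp>0)"] F[of "r i"] by (auto simp: inc_def)
  qed
  moreover have "Y \<in> Sets M"
  proof -
    have "\<chi> \<in> Sets M" using \<chi> by (simp add: is_fun_def)
    then have "{u. sat M ((\<lambda>_. c (cst \<sharp>1))(0 := u)) (\<lambda>_. \<chi>) (Mem (tpair (tpair (tnum 1) (Var 0)) (Var 1)) 0)} \<in> Sets M"
      by (intro Sigma00_comprehension Sigma00.intros)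
    then show ?thesis using is_funD(1)[OF \<chi>] by (simp add: Y_def c_def pos_def)
  qed
  ultimately show ?thesis by blast
qed

lemma kernel_imp_cf:
  assumes Y: "Y \<in> Sets M" "kernel R Y" "r i \<in> Y"
  shows "colorable_cf k (hyp_at M hyp i)"
proof -
  have kerD: "v \<notin> Y" if "\<langle>v, u\<rangle> \<in> R" "u \<in> Y" for u v
    using Y(2) that unfolding kernel_def by blast
  have kerE: "\<exists>v. \<langle>v, u\<rangle> \<in> R \<and> v \<in> Y" if "u \<notin> Y" for u
    using Y(2) that unfolding kernel_def by blast
  \<comment> \<open>\<open>L v u\<close> designates the least input of u in Y. For u outside Y it
    exists because the candidates form a set of the model, and thus exactly one selector of u
    becomes true.\<close>
  define L where "L v u \<longleftrightarrow> \<langle>v, u\<rangle> \<in> R \<and> v \<in> Y \<and> (\<forall>v'. v' \<prec> v \<longrightarrow> \<not> (\<langle>v', u\<rangle> \<in> R \<and> v' \<in> Y))" for v u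
  have L_unique: "v = v'" if "L v u" "L v' u" for u v v'
    using that lt_linear[of v v'] unfolding L_def by blast
  have L_ex: "\<exists>v. L v u" if u: "u \<notin> Y" for u
  proof -
    have "{v. \<langle>v, u\<rangle> \<in> R} \<inter> Y \<in> Sets M"
      using Int_Sets[OF column_Sets[OF R, of u] Y(1)] by (simp add: column_def)
    moreover obtain v where "v \<in> {v. \<langle>v, u\<rangle> \<in> R} \<inter> Y" using kerE[OF u] by blast
    ultimately obtain b where "b \<in> {v. \<langle>v, u\<rangle> \<in> R} \<inter> Y" "\<forall>c. c \<prec> b \<longrightarrow> c \<notin> {v. \<langle>v, u\<rangle> \<in> R} \<inter> Y"
      using least_element by meson
    then show ?thesis unfolding L_def by blast
  qed
  define T where "T = {cst \<sharp>1} \<union> {pos u | u. u \<in> Y} \<union> {neg u | u. u \<notin> Y} \<union> {sel v u | v u. L v u}"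
  have T: "cst s \<in> T \<longleftrightarrow> s = \<sharp>1" "pos u \<in> T \<longleftrightarrow> u \<in> Y" "neg u \<in> T \<longleftrightarrow> u \<notin> Y" "sel v u \<in> T \<longleftrightarrow> L v u" for s u v
    by (auto simp: T_def)
  have "T \<in> Sets M"
  proof -
    have "{tm_val M v (tpair (tnum 1) (Var 0)) | v. sat M v (\<lambda>_. Y) (Mem (Var 0) 0)} \<in> Sets M"
      by (rule arithmetical_image) (simp_all add: Y)
    also have "{tm_val M v (tpair (tnum 1) (Var 0)) | v. sat M v (\<lambda>_. Y) (Mem (Var 0) 0)} = {pos u | u. u \<in> Y}"
      by (auto simp: pos_def intro: exI[of _ "\<lambda>_. _"])
    finally have 1: "{pos u | u. u \<in> Y} \<in> Sets M" .
    have "{tm_val M v (tpair (tnum 2) (Var 0)) | v. sat M v (\<lambda>_. Y) (Neg (Mem (Var 0) 0))} \<in> Sets M"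
      by (rule arithmetical_image) (simp_all add: Y)
    also have "{tm_val M v (tpair (tnum 2) (Var 0)) | v. sat M v (\<lambda>_. Y) (Neg (Mem (Var 0) 0))} = {neg u | u. u \<notin> Y}"
      by (auto simp: neg_def intro: exI[of _ "\<lambda>_. _"])
    finally have 2: "{neg u | u. u \<notin> Y} \<in> Sets M" .
    let ?p = "And (Mem (tpair (Var 0) (Var 1)) 0) (And (Mem (Var 0) 1)
       (AllN 2 (Imp (Less (Var 2) (Var 0)) (Neg (And (Mem (tpair (Var 2) (Var 1)) 0) (Mem (Var 2) 1))))))"
    have "{tm_val M v (tpair (tnum 3) (tpair (Var 0) (Var 1))) | v. sat M v ((\<lambda>_. R)(1 := Y)) ?p} \<in> Sets M"
      by (rule arithmetical_image) (simp_all add: Y R)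
    also have "{tm_val M v (tpair (tnum 3) (tpair (Var 0) (Var 1))) | v. sat M v ((\<lambda>_. R)(1 := Y)) ?p}
        = {sel (v 0) (v 1) | v :: nat \<Rightarrow> 'a. L (v 0) (v 1)}"
      by (simp add: sel_def L_def)
    also have "\<dots> = {sel v u | v u. L v u}"
    proof -
      have "\<exists>w::nat \<Rightarrow> 'a. w 0 = v \<and> w 1 = u" for u v
        by (rule exI[of _ "\<lambda>n. if n = 0 then v else u"]) simp
      then show ?thesis by (simp add: set_eq_iff) metis
    qed
    finally have 3: "{sel v u | v u. L v u} \<in> Sets M" .
    show ?thesis unfolding T_def by (intro Un_Sets singleton_Sets 1 2 3)
  qed
  \<comment> \<open>Color 1 is true. The palette vertices 2 to k - 1 keep their own colors, and 0 is
    the default, shared by \<open>cst \<sharp>0\<close>, \<open>cst \<sharp>k\<close>, the false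
    vertices and the numbers without a role.\<close>
  define g where "g w = (if w \<in> T then 1 else if \<exists>s. 2 \<le> s \<and> s < k \<and> w = cst \<sharp>s then THE s. w = cst \<sharp>s else 0)" for w
  have g_T: "g w = 1 \<longleftrightarrow> w \<in> T" for w by (auto simp: g_def)
  have g_cst: "g (cst \<sharp>s) = s" if "s < k" for s
    using that by (auto simp: g_def T)
  have g_cst_k: "g (cst \<sharp>k) = 0" using k by (auto simp: g_def T)
  have g_0: "g w = 0" if "w \<notin> T" "\<And>s. w \<noteq> cst s" for w using that by (auto simp: g_def)
  have g_pos: "g (pos u) = (if u \<in> Y then 1 else 0)" and g_neg: "g (neg u) = (if u \<in> Y then 0 else 1)"
    and g_sel: "g (sel v u) = (if L v u then 1 else 0)" for u v
    using g_T g_0 T by auto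
  have g_lt: "g w < k" for w using k by (auto simp: g_def)
  have "{w. g w = s} \<in> Sets M" if "s < k" for s
  proof -
    have other: "{w. g w = s} = {cst \<sharp>s}" if "2 \<le> s" "s < k" for s
      using that g_cst[of s] by (auto simp: g_def T split: if_splits)
    have one: "{w. g w = 1} = T" using g_T by auto
    \<comment> \<open>The fiber of the default color is the complement of the others, which are
      \<open>T\<close> and singletons.\<close>
    have "{w. g w = 0} = - (\<Union>s\<in>{1..<k}. {w. g w = s})"
      using g_lt by (auto simp: Suc_le_eq)
    moreover have "(\<Union>s\<in>{1..<k}. {w. g w = s}) \<in> Sets M"
    proof (rule finite_UN_Sets)
      fix s assume "s \<in> {1..<k}"
      then show "{w. g w = s} \<in> Sets M"
        using one other[of s] \<open>T \<in> Sets M\<close> singleton_Sets by (cases "s = 1") auto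
    qed simp
    ultimately have "{w. g w = 0} \<in> Sets M" using Compl_Sets by metis
    then show ?thesis using one other[of s] \<open>T \<in> Sets M\<close> singleton_Sets that
      by (cases "s = 0"; cases "s = 1") auto
  qed
  then obtain \<chi> where \<chi>: "is_fun M \<chi> UNIV (below M k)" "\<And>w. app M \<chi> w = \<sharp>(g w)"
    using function_of_fibers[of g k] g_lt by blast
  have unique: "\<exists>c. \<exists>!w. inc w j i \<and> app M \<chi> w = c" if "inc w j i" "\<And>w'. inc w' j i \<Longrightarrow> g w' = g w \<Longrightarrow> w' = w" for j w
    using that by (intro exI[of _ "app M \<chi> w"] ex1I[of _ w]) (auto simp: \<chi>(2))
  have g_c: "g (cst \<sharp>0) = 0" "g (cst \<sharp>(Suc 0)) = 1" using g_cst k by auto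
  note g = g_cst_k g_pos g_neg g_sel g_c
  have "\<exists>c. \<exists>!w. inc w j i \<and> app M \<chi> w = c" if "inc w j i" for w j
  proof -
    from that consider
      (1) s t where "j = \<langle>\<sharp>0, \<langle>s, t\<rangle>\<rangle>" "s \<prec> t" "t \<prec> \<sharp>(Suc k)" "\<not> (s = \<sharp>0 \<and> t = \<sharp>k)"
    | (2) s c y where "j = \<langle>\<sharp>1, \<langle>s, \<langle>c, y\<rangle>\<rangle>\<rangle>" "\<sharp>1 \<prec> s" "s \<prec> \<sharp>k" "\<sharp>0 \<prec> c" "c \<prec> \<sharp>4"
    | (3) u where "j = \<langle>\<sharp>2, u\<rangle>"
    | (4) u where "j = \<langle>\<sharp>3, u\<rangle>"
    | (5) v u where "j = \<langle>\<sharp>4, \<langle>v, u\<rangle>\<rangle>" "\<langle>v, u\<rangle> \<in> R"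
    | (6) v u where "j = \<langle>\<sharp>5, \<langle>v, u\<rangle>\<rangle>" "\<langle>v, u\<rangle> \<in> R"
    | (7) "j = \<langle>\<sharp>6, \<sharp>0\<rangle>"
      unfolding inc_def by blast
    then show ?thesis
    proof cases
      case 1
      obtain b where b: "b \<le> k" "t = \<sharp>b" using 1(3) by (auto simp: lt_numer_iff)
      then obtain a where a: "a < b" "s = \<sharp>a" using 1(2) by (auto simp: lt_numer_iff)
      have "g (cst \<sharp>b) \<noteq> g (cst \<sharp>a)"
        using a b 1(4) g_cst[of a] g_cst[of b] g_cst_k by (cases "b = k") auto
      then show ?thesis using 1 a b by (intro unique[of "cst s"]) (auto simp: inc_def)
    next
      case 2
      obtain a where a: "a < k" "s = \<sharp>a" using 2(3) by (auto simp: lt_numer_iff)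
      have "1 < a" using 2(2) a by simp
      \<comment> \<open>Colors above 1 occur only at palette vertices, which have tag 0, whereas c
        is not \<sharp>0.\<close>
      have "g \<langle>c, y\<rangle> \<le> 1"
        using 2(4) by (auto simp: g_def cst_def)
      then have "g \<langle>c, y\<rangle> \<noteq> g (cst \<sharp>a)" using g_cst[OF a(1)] \<open>1 < a\<close> by simp
      then show ?thesis using 2 a by (intro unique[of "cst s"]) (auto simp: inc_def)
    next
      case 3
      then show ?thesis by (intro unique[of "pos u"]) (auto simp: inc_def g split: if_splits)
    next
      case 4
      show ?thesis
      proof (cases "u \<in> Y")
        case True
        then have "\<not> L v u" for v using kerD by (auto simp: L_def)
        then show ?thesis using 4 True by (intro unique[of "pos u"]) (auto simp: inc_def g)
      next
        case False
        then obtain v where v: "L v u" using L_ex by blast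
        then have "\<langle>v, u\<rangle> \<in> R" by (simp add: L_def)
        moreover have "L v' u \<longleftrightarrow> v' = v" for v' using v L_unique by blast
        ultimately show ?thesis using 4 False
          by (intro unique[of "sel v u"]) (auto simp: inc_def g split: if_splits)
      qed
    next
      case 5
      \<comment> \<open>At most one end of the arc is in Y. If one is, the other is the only false
        vertex of the edge; if neither is, \<open>cst \<sharp>1\<close> is the only true
        one.\<close>
      then show ?thesis using kerD[OF 5(2)]
        by (intro unique[of "if u \<in> Y then pos v else if v \<in> Y then pos u else cst \<sharp>1"])
          (auto simp: inc_def g split: if_splits)
    next
      case 6
      have "L v u \<Longrightarrow> v \<in> Y" by (simp add: L_def)
      \<comment> \<open>If the selector is true, v is in Y and \<open>neg v\<close> is the only
        false vertex. Otherwise the selector is false: for v in Y so is \<open>neg v\<close>, which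
        leaves \<open>cst \<sharp>1\<close> as the only true vertex, and for v outside Y the
        selector is the only false one.\<close>
      then show ?thesis using 6
        by (intro unique[of "if L v u then neg v else if v \<in> Y then cst \<sharp>1 else sel v u"])
          (auto simp: inc_def g split: if_splits)
    next
      case 7
      then show ?thesis using Y(3) by (intro unique[of "cst \<sharp>0"]) (auto simp: inc_def g)
    qed
  qed
  then have "conflict_free M (hyp_at M hyp i) \<chi>"
    unfolding conflict_free_def edges_hyp by auto
  then show ?thesis using \<chi>(1) unfolding colorable_cf_def is_coloring_hyp by blast
qed

lemma kernels_Sets:
  assumes "decides k"
  shows "{i. \<exists>Y\<in>Sets M. kernel R Y \<and> r i \<in> Y} \<in> Sets M"
proof (rule assms[unfolded decides_def, rule_format, OF hyp_seq])
  fix i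
  show "\<exists>Y\<in>Sets M. kernel R Y \<and> r i \<in> Y" if "colorable_proper k (hyp_at M hyp i)"
    using that proper_imp_kernel unfolding colorable_proper_def is_coloring_hyp by blast
  show "colorable_cf k (hyp_at M hyp i)" if "\<exists>Y\<in>Sets M. kernel R Y \<and> r i \<in> Y"
    using that kernel_imp_cf by blast
qed

end

lemma (in rca0) decides_imp_Pi11_CA0:
  assumes "decides k" "k \<ge> 2"
  shows "Pi11_CA0 M"
proof -
  interpret aca0 M
    by unfold_locales (use decides_projection assms in auto)
  have "Pi11_comprehension M"
  proof (rule Pi11_comprehensionI)
    fix R r
    assume "R \<in> Sets M" "{\<langle>r i, i\<rangle> | i. True} \<in> Sets M"
    then interpret kernel_hypergraph M k R r
      by unfold_locales (use assms in auto)
    show "{i. \<exists>Y\<in>Sets M. kernel R Y \<and> r i \<in> Y} \<in> Sets M" by (rule kernels_Sets[OF assms(1)])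
  qed
  then show ?thesis using RCA0 by (simp add: Pi11_CA0_def)
qed

section \<open>Coloring principles from comprehension\<close>

context rca0 begin

lemma Sigma11_comprehension:
  assumes "Pi11_CA0 M" "arithmetical p" "\<And>n. E n \<in> Sets M"
  shows "{n. \<exists>A\<in>Sets M. sat M (e(x := n)) (E(X := A)) p} \<in> Sets M"
proof -
  have "Pi11 (AllS X (Neg p))" using assms(2) by (simp add: Pi11.intros)
  moreover have "range E \<subseteq> Sets M" using assms(3) by auto
  moreover have "Pi11_comprehension M" using assms(1) by (simp add: Pi11_CA0_def)
  ultimately obtain A where "A \<in> Sets M" "\<forall>n. n \<in> A \<longleftrightarrow> sat M (e(x := n)) E (AllS X (Neg p))"
    unfolding Pi11_comprehension_def by (metis (no_types, lifting))
  then have "- A \<in> Sets M" "- A = {n. \<exists>A\<in>Sets M. sat M (e(x := n)) (E(X := A)) p}"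
    using Compl_Sets by auto
  then show ?thesis by simp
qed

text \<open>In the following formulas the set variables 0, 1, 2, 3 are the coloring and the vertex, index and
  incidence sets of the sequence, and the number variable 0 is the position in the sequence.\<close>

definition coloring_form :: "nat \<Rightarrow> form" where
  "coloring_form k = And
     (AllN 1 (Imp (Mem (Var 1) 0) (ExN 2 (And (Mem (tpair (Var 2) (Var 0)) 1)
        (ExN 3 (And (Less (Var 3) (tnum k)) (Eq (Var 1) (tpair (Var 2) (Var 3)))))))))
     (AllN 1 (Imp (Mem (tpair (Var 1) (Var 0)) 1)
        (ExN 2 (And (Mem (tpair (Var 1) (Var 2)) 0)
           (AllN 3 (Imp (Mem (tpair (Var 1) (Var 3)) 0) (Eq (Var 3) (Var 2))))))))"

abbreviation tinc :: "nat \<Rightarrow> tm" where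
  "tinc u \<equiv> tpair (tpair (Var u) (Var 1)) (Var 0)"

text \<open>The language has no function application, so distinct colors are expressed through the
  graph: some color is paired with one vertex and not with the other.\<close>

definition proper_form :: form where
  "proper_form = AllN 1 (Imp (Mem (tpair (Var 1) (Var 0)) 2)
     (Imp (ExN 2 (And (Mem (tinc 2) 3) (ExN 3 (And (Mem (tinc 3) 3) (Neg (Eq (Var 2) (Var 3)))))))
        (ExN 2 (And (Mem (tinc 2) 3) (ExN 3 (And (Mem (tinc 3) 3)
           (ExN 4 (And (Mem (tpair (Var 2) (Var 4)) 0) (Neg (Mem (tpair (Var 3) (Var 4)) 0))))))))))"

definition conflict_free_form :: form where
  "conflict_free_form = AllN 1 (Imp (Mem (tpair (Var 1) (Var 0)) 2)
     (ExN 4 (ExN 2 (And (And (Mem (tinc 2) 3) (Mem (tpair (Var 2) (Var 4)) 0))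
        (AllN 3 (Imp (And (Mem (tinc 3) 3) (Mem (tpair (Var 3) (Var 4)) 0)) (Eq (Var 3) (Var 2))))))))"

text \<open>The default value is intended for set variable 1. Variable 0 is overwritten by the
  coloring, and variables above 3 do not occur in the formulas.\<close>

definition seq_sets :: "'m hypergraph \<Rightarrow> nat \<Rightarrow> 'm set" where
  "seq_sets H = (\<lambda>_. Vert H)(2 := Idx H, 3 := Inc H)"

lemma sat_coloring_form:
  assumes "\<chi> \<in> Sets M"
  shows "sat M (e(0 := i)) ((seq_sets H)(0 := \<chi>)) (coloring_form k) \<longleftrightarrow> is_coloring M k (hyp_at M H i) \<chi>"
  using assms
  by (simp add: coloring_form_def seq_sets_def is_coloring_def is_fun_def hyp_at_def column_def below_def
      Ball_def Bex_def Ex1_def)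

lemma ball_edges_hyp_at:
  "(\<forall>e\<in>edges M (hyp_at M H i). P e) \<longleftrightarrow> (\<forall>j. \<langle>j, i\<rangle> \<in> Idx H \<longrightarrow> P {w. \<langle>\<langle>w, j\<rangle>, i\<rangle> \<in> Inc H})"
  unfolding edges_hyp_at by blast

text \<open>Edges consist of vertices, so on an edge \<open>app\<close> returns a genuine value of
  the coloring and not an unspecified \<open>THE\<close>.\<close>

lemma app_eq_iff:
  assumes H: "is_hypergraph_seq M H" and \<chi>: "is_coloring M k (hyp_at M H i) \<chi>"
    and "\<langle>j, i\<rangle> \<in> Idx H" "\<langle>\<langle>u, j\<rangle>, i\<rangle> \<in> Inc H"
  shows "app M \<chi> u = c \<longleftrightarrow> \<langle>u, c\<rangle> \<in> \<chi>"
proof -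
  have "{w. \<langle>\<langle>w, j\<rangle>, i\<rangle> \<in> Inc H} \<in> edges M (hyp_at M H i)"
    using assms(3) by (auto simp: edges_hyp_at)
  then have "{w. \<langle>\<langle>w, j\<rangle>, i\<rangle> \<in> Inc H} \<subseteq> Vert (hyp_at M H i)"
    using H by (simp add: is_hypergraph_seq_def is_hypergraph_def)
  then have "u \<in> Vert (hyp_at M H i)" using assms(4) by blast
  then show ?thesis using is_funD(1)[OF \<chi>[unfolded is_coloring_def]] by simp
qed

lemma sat_proper_form:
  assumes H: "is_hypergraph_seq M H" and \<chi>: "is_coloring M k (hyp_at M H i) \<chi>"
  shows "sat M (e(0 := i)) ((seq_sets H)(0 := \<chi>)) proper_form \<longleftrightarrow> proper M (hyp_at M H i) \<chi>"
proof -
  have "sat M (e(0 := i)) ((seq_sets H)(0 := \<chi>)) proper_form \<longleftrightarrow> (\<forall>j. \<langle>j, i\<rangle> \<in> Idx H \<longrightarrow>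
      (\<exists>u. \<langle>\<langle>u, j\<rangle>, i\<rangle> \<in> Inc H \<and> (\<exists>v. \<langle>\<langle>v, j\<rangle>, i\<rangle> \<in> Inc H \<and> u \<noteq> v)) \<longrightarrow>
      (\<exists>u. \<langle>\<langle>u, j\<rangle>, i\<rangle> \<in> Inc H \<and> (\<exists>v. \<langle>\<langle>v, j\<rangle>, i\<rangle> \<in> Inc H \<and> (\<exists>c. \<langle>u, c\<rangle> \<in> \<chi> \<and> \<langle>v, c\<rangle> \<notin> \<chi>))))"
    by (simp add: proper_form_def seq_sets_def)
  also have "\<dots> \<longleftrightarrow> (\<forall>j. \<langle>j, i\<rangle> \<in> Idx H \<longrightarrow>
      (\<exists>u. \<langle>\<langle>u, j\<rangle>, i\<rangle> \<in> Inc H \<and> (\<exists>v. \<langle>\<langle>v, j\<rangle>, i\<rangle> \<in> Inc H \<and> u \<noteq> v)) \<longrightarrow>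
      (\<exists>u. \<langle>\<langle>u, j\<rangle>, i\<rangle> \<in> Inc H \<and> (\<exists>v. \<langle>\<langle>v, j\<rangle>, i\<rangle> \<in> Inc H \<and> app M \<chi> u \<noteq> app M \<chi> v)))"
  proof -
    have "(\<exists>c. \<langle>u, c\<rangle> \<in> \<chi> \<and> \<langle>v, c\<rangle> \<notin> \<chi>) \<longleftrightarrow> app M \<chi> u \<noteq> app M \<chi> v"
      if "\<langle>j, i\<rangle> \<in> Idx H" "\<langle>\<langle>u, j\<rangle>, i\<rangle> \<in> Inc H" "\<langle>\<langle>v, j\<rangle>, i\<rangle> \<in> Inc H" for u v j
      unfolding app_eq_iff[OF H \<chi> that(1,2), symmetric] app_eq_iff[OF H \<chi> that(1,3), symmetric] by auto
    then show ?thesis by meson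
  qed
  also have "\<dots> \<longleftrightarrow> proper M (hyp_at M H i) \<chi>"
    unfolding proper_def ball_edges_hyp_at by (simp add: Bex_def)
  finally show ?thesis .
qed

lemma sat_conflict_free_form:
  assumes H: "is_hypergraph_seq M H" and \<chi>: "is_coloring M k (hyp_at M H i) \<chi>"
  shows "sat M (e(0 := i)) ((seq_sets H)(0 := \<chi>)) conflict_free_form \<longleftrightarrow> conflict_free M (hyp_at M H i) \<chi>"
proof -
  have "sat M (e(0 := i)) ((seq_sets H)(0 := \<chi>)) conflict_free_form \<longleftrightarrow> (\<forall>j. \<langle>j, i\<rangle> \<in> Idx H \<longrightarrow>
      (\<exists>c. \<exists>!v. \<langle>\<langle>v, j\<rangle>, i\<rangle> \<in> Inc H \<and> \<langle>v, c\<rangle> \<in> \<chi>))"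
    by (simp add: conflict_free_form_def seq_sets_def Ex1_def)
  also have "\<dots> \<longleftrightarrow> (\<forall>j. \<langle>j, i\<rangle> \<in> Idx H \<longrightarrow> (\<exists>c. \<exists>!v. \<langle>\<langle>v, j\<rangle>, i\<rangle> \<in> Inc H \<and> app M \<chi> v = c))"
  proof -
    have "(\<langle>\<langle>v, j\<rangle>, i\<rangle> \<in> Inc H \<and> \<langle>v, c\<rangle> \<in> \<chi>) \<longleftrightarrow> (\<langle>\<langle>v, j\<rangle>, i\<rangle> \<in> Inc H \<and> app M \<chi> v = c)"
      if "\<langle>j, i\<rangle> \<in> Idx H" for v j c
      using app_eq_iff[OF H \<chi> that] by blast
    then show ?thesis by simp
  qed
  also have "\<dots> \<longleftrightarrow> conflict_free M (hyp_at M H i) \<chi>"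
    unfolding conflict_free_def ball_edges_hyp_at by simp
  finally show ?thesis .
qed

lemma Pi11_CA0_imp_principles:
  assumes "Pi11_CA0 M"
  shows "proper_coloring_principle M k" "conflict_free_coloring_principle M k"
proof -
  \<comment> \<open>Shared by both principles: q expresses the condition P, and has to agree with it
    only on actual colorings.\<close>
  have main: "\<exists>f. is_fun M f UNIV (below M 2) \<and>
      (\<forall>i. app M f i = \<one> \<longleftrightarrow> (\<exists>\<chi>. is_coloring M k (hyp_at M H i) \<chi> \<and> P i \<chi>))"
    if H: "is_hypergraph_seq M H" and q: "arithmetical q"
      and P: "\<And>e i \<chi>. is_coloring M k (hyp_at M H i) \<chi> \<Longrightarrow>
        sat M (e(0 := i)) ((seq_sets H)(0 := \<chi>)) q \<longleftrightarrow> P i \<chi>" for H q P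
  proof -
    have "{i. \<exists>\<chi>\<in>Sets M. sat M ((\<lambda>_. \<zero>)(0 := i)) ((seq_sets H)(0 := \<chi>)) (And (coloring_form k) q)} \<in> Sets M"
      using assms
      by (rule Sigma11_comprehension) (use q H in \<open>auto simp: coloring_form_def seq_sets_def is_hypergraph_seq_def\<close>)
    moreover have "(\<exists>\<chi>\<in>Sets M. sat M ((\<lambda>_. \<zero>)(0 := i)) ((seq_sets H)(0 := \<chi>)) (And (coloring_form k) q)) \<longleftrightarrow>
       (\<exists>\<chi>. is_coloring M k (hyp_at M H i) \<chi> \<and> P i \<chi>)" for i
    proof -
      have "\<chi> \<in> Sets M" if "is_coloring M k (hyp_at M H i) \<chi>" for \<chi>
        using that by (simp add: is_coloring_def is_fun_def)
      then show ?thesis unfolding sat.simps using sat_coloring_form P by blast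
    qed
    ultimately have "{i. \<exists>\<chi>. is_coloring M k (hyp_at M H i) \<chi> \<and> P i \<chi>} \<in> Sets M" by simp
    from indicator_function[OF this] show ?thesis by simp
  qed
  show "proper_coloring_principle M k" unfolding proper_coloring_principle_def
  proof (intro allI impI)
    fix H assume H: "is_hypergraph_seq M H"
    show "\<exists>f. is_fun M f UNIV (below M 2) \<and>
      (\<forall>i. app M f i = \<one> \<longleftrightarrow> (\<exists>\<chi>. is_coloring M k (hyp_at M H i) \<chi> \<and> proper M (hyp_at M H i) \<chi>))"
      by (rule main[OF H _ sat_proper_form[OF H]]) (simp_all add: proper_form_def)
  qed
  show "conflict_free_coloring_principle M k" unfolding conflict_free_coloring_principle_def
  proof (intro allI impI)
    fix H assume H: "is_hypergraph_seq M H"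
    show "\<exists>f. is_fun M f UNIV (below M 2) \<and>
      (\<forall>i. app M f i = \<one> \<longleftrightarrow> (\<exists>\<chi>. is_coloring M k (hyp_at M H i) \<chi> \<and> conflict_free M (hyp_at M H i) \<chi>))"
      by (rule main[OF H _ sat_conflict_free_form[OF H]]) (simp_all add: conflict_free_form_def)
  qed
qed

end

theorem theorem13:
  fixes M :: "'m l2_structure" and k :: nat
  assumes "k \<ge> 2"
    and "RCA0 M"
  shows "(Pi11_CA0 M \<longleftrightarrow> proper_coloring_principle M k) \<and>
         (Pi11_CA0 M \<longleftrightarrow> conflict_free_coloring_principle M k)"
proof -
  interpret rca0 M using assms(2) by unfold_locales
  show ?thesis
    using Pi11_CA0_imp_principles decidesI decides_imp_Pi11_CA0 assms(1) by blast
qed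

end
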